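(* Let $q$ be a prime power and let $q_n(Y_{f_1};q)$, $n\ge 0$, be the elements of $\mathcal F_G$ defined by $$\sum_{n\ge 0}q_n(Y_{f_1};q)z^n=\exp\Big(-\sum_{n\ge1}\frac{1-q^{-n}}{n}\,p_n(f_1)z^n\Big).$$ Then for every $n\ge 0$ $$q_n(Y_{f_1};q)=\Big(\frac{-1}{q}\Big)^{n}\sum_{\tilde{\boldsymbol\lambda}\in\mathcal P_n^{\Phi^*}}\frac{1}{Z_{\tilde{\boldsymbol\lambda}}}\,p_{\tilde{\boldsymbol\lambda}},\qquad p_{\tilde{\boldsymbol\lambda}}=\prod_{\phi\in\Phi^*}p_{\tilde{\boldsymbol\lambda}(\phi)}(\phi).$$ Moreover, $$q_n(Y_{f_1};q)=\Big(\frac{-1}{q}\Big)^{n}\sum_{\tilde{\boldsymbol\lambda}}\ \prod_{\phi\in\Phi^*}s_{\tilde{\boldsymbol\lambda}(\phi)}(\phi),$$ where the sum runs over all $\tilde{\boldsymbol\lambda}\in\mathcal P_n^{\Phi^*}$ such that $l(\tilde{\boldsymbol\lambda}(\phi))\le 1$ for each $\phi\in\Phi^*$.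
   Context: $M_n=\mathbb F_{q^n}^\times$, and $M_n^*$ is the group of complex characters of $M_n$, with $M_m^*\subset M_n^*$ for $m\mid n$ (via the norm map $M_n\to M_m$); $M^*=\bigcup_n M_n^*$. The Frobenius acts on $M^*$ by $\xi\mapsto \xi^q$; $\Phi^*$ is the set of Frobenius orbits in $M^*$, $|\phi|$ is the size of the orbit $\phi$, and $\Phi_n^*=\{\phi\in\Phi^*: |\phi| \text{ divides } n\}$. $\mathcal F_G=\bigotimes_{\phi\in\Phi^*}\mathbb C[p_n(\phi):n\ge1]$ is the polynomial algebra on independent generators $p_n(\phi)$ ($n\ge 1$, $\phi\in\Phi^*$), where $p_n(\phi)$ is viewed as the $n$-th power sum in a set of variables attached to $\phi$. For a partition $\lambda$, $p_\lambda(\phi)=\prod_i p_{\lambda_i}(\phi)$, and $s_\lambda(\phi)$ is the Schur function expressed in the power sums $p_n(\phi)$. With $f_1=t-1$, the elements $p_n(f_1)\in\mathcal F_G$ are $$p_n(f_1)=\frac{(-1)^{n-1}}{q^n-1}\sum_{\phi\in\Phi_n^*}|\phi|\,p_{n/|\phi|}(\phi).$$ A $\Phi^*$-colored partition is a map $\tilde{\boldsymbol\lambda}:\Phi^*\to\{\text{partitions}\}$, with weight $\|\tilde{\boldsymbol\lambda}\|=\sum_\phi|\phi||\tilde{\boldsymbol\lambda}(\phi)|$; $\mathcal P_n^{\Phi^*}$ is the set of those of weight $n$ (so all but finitely many $\tilde{\boldsymbol\lambda}(\phi)$ are empty). $l(\lambda)$ is the number of nonzero parts of $\lambda$. $Z_{\tilde{\boldsymbol\lambda}}=\prod_{\phi\in\Phi^*}z_{\tilde{\boldsymbol\lambda}(\phi)}$,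 where $z_\lambda=\prod_{i\ge1}i^{m_i}m_i!$ for $\lambda=(1^{m_1}2^{m_2}\cdots)$. *)

theory Defs
  imports
    Complex_Main
    "HOL-Library.Poly_Mapping"
    "HOL-Library.Multiset"
    "HOL-Computational_Algebra.Computational_Algebra"
begin

section \<open>The groups \<open>M\<^sub>n\<close>, their characters, and Frobenius orbits\<close>

text \<open>All finite fields of order \<open>q ^ n\<close> are taken inside one algebraically closed field
  \<open>'k\<close> whose characteristic is the prime dividing \<open>q\<close>; the subfield of order \<open>q ^ n\<close> is the
  fixed field of \<open>x \<mapsto> x ^ (q ^ n)\<close>. All levels \<open>n\<close> below are positive.\<close>

definition M_gp :: "nat \<Rightarrow> nat \<Rightarrow> 'k::alg_closed_field set" where
  "M_gp q n = {x. x \<noteq> 0 \<and> x ^ (q ^ n) = x}"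

text \<open>For \<open>m dvd n\<close>, the norm \<open>M_gp q n \<rightarrow> M_gp q m\<close>: the product of the Galois conjugates.\<close>

definition norm_map :: "nat \<Rightarrow> nat \<Rightarrow> nat \<Rightarrow> 'k::alg_closed_field \<Rightarrow> 'k" where
  "norm_map q n m x = (\<Prod>i<n div m. x ^ (q ^ (m * i)))"

text \<open>A character is made a total function by the convention that it vanishes off \<open>M_gp q n\<close>.\<close>

definition M_dual :: "nat \<Rightarrow> nat \<Rightarrow> ('k::alg_closed_field \<Rightarrow> complex) set" where
  "M_dual q n = {\<chi>. (\<forall>x\<in>M_gp q n. \<chi> x \<noteq> 0) \<and>
                     (\<forall>x\<in>M_gp q n. \<forall>y\<in>M_gp q n. \<chi> (x * y) = \<chi> x * \<chi> y) \<and>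
                     (\<forall>x. x \<notin> M_gp q n \<longrightarrow> \<chi> x = 0)}"

definition inflate :: "nat \<Rightarrow> nat \<Rightarrow> nat \<Rightarrow> ('k::alg_closed_field \<Rightarrow> complex) \<Rightarrow> ('k \<Rightarrow> complex)" where
  "inflate q m n \<chi> = (\<lambda>x. if x \<in> M_gp q n then \<chi> (norm_map q n m x) else 0)"

text \<open>The union of the \<open>M_dual q n\<close> along the inclusions \<open>inflate\<close> is formed as a direct limit:
  a character of level \<open>m\<close> and one of level \<open>n\<close> are identified iff they have the same
  inflation to some common multiple of \<open>m\<close> and \<open>n\<close>.\<close>

type_synonym 'k mchar = "(nat \<times> ('k \<Rightarrow> complex)) set"

definition dual_rel :: "nat \<Rightarrow> ((nat \<times> ('k::alg_closed_field \<Rightarrow> complex)) \<times> (nat \<times> ('k \<Rightarrow> complex))) set" where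
  "dual_rel q = {((m, \<chi>), (n, \<psi>)) | m \<chi> n \<psi>.
     0 < m \<and> 0 < n \<and> \<chi> \<in> M_dual q m \<and> \<psi> \<in> M_dual q n \<and>
     (\<exists>N>0. m dvd N \<and> n dvd N \<and> inflate q m N \<chi> = inflate q n N \<psi>)}"

definition Mstar :: "nat \<Rightarrow> 'k::alg_closed_field mchar set" where
  "Mstar q = (SIGMA n:{0<..}. M_dual q n) // dual_rel q"

definition frobenius :: "nat \<Rightarrow> 'k::alg_closed_field mchar \<Rightarrow> 'k mchar" where
  "frobenius q \<xi> = dual_rel q `` {(n, \<lambda>x. \<chi> x ^ q) | n \<chi>. (n, \<chi>) \<in> \<xi>}"

type_synonym 'k orbit = "'k mchar set"

definition Phi :: "nat \<Rightarrow> 'k::alg_closed_field orbit set" where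
  "Phi q = (\<lambda>\<xi>. range (\<lambda>i. (frobenius q ^^ i) \<xi>)) ` Mstar q"

definition Phi_level :: "nat \<Rightarrow> nat \<Rightarrow> 'k::alg_closed_field orbit set" where
  "Phi_level q n = {\<phi> \<in> Phi q. card \<phi> dvd n}"


section \<open>Polynomial algebras over the complex numbers\<close>

text \<open>Polynomials with variables in \<open>'v\<close>: finitely supported functions from monomials
  (exponent vectors of finite support) to coefficients.\<close>

type_synonym 'v cpoly = "('v \<Rightarrow>\<^sub>0 nat) \<Rightarrow>\<^sub>0 complex"

definition cst :: "complex \<Rightarrow> 'v cpoly" where
  "cst c = Poly_Mapping.single 0 c"

definition var :: "'v \<Rightarrow> 'v cpoly" where
  "var v = Poly_Mapping.single (Poly_Mapping.single v 1) 1"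

definition subst_poly :: "('v \<Rightarrow> 'w cpoly) \<Rightarrow> 'v cpoly \<Rightarrow> 'w cpoly" where
  "subst_poly f P =
     (\<Sum>m\<in>Poly_Mapping.keys P. cst (Poly_Mapping.lookup P m) *
        (\<Prod>v\<in>Poly_Mapping.keys m. f v ^ Poly_Mapping.lookup m v))"

text \<open>Exponential of a power series with zero constant term (the library's \<open>fps_exp\<close> requires
  coefficients in a field).\<close>

definition exp_fps :: "'v cpoly fps \<Rightarrow> 'v cpoly fps" where
  "exp_fps F = fps_compose (Abs_fps (\<lambda>k. cst (1 / fact k))) F"


section \<open>The algebra \<open>F_G\<close>\<close>

text \<open>The variable \<open>(n, \<phi>)\<close> is the generator \<open>p\<^sub>n(\<phi>)\<close>. Only the variables with \<open>n \<ge> 1\<close> and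
  \<open>\<phi> \<in> Phi q\<close> belong to the algebra, so it is a subset of the type.\<close>

type_synonym 'k FG = "(nat \<times> 'k orbit) cpoly"

definition F_G :: "nat \<Rightarrow> 'k::alg_closed_field FG set" where
  "F_G q = {P. \<forall>m\<in>Poly_Mapping.keys P. Poly_Mapping.keys m \<subseteq> {1..} \<times> Phi q}"

definition p_gen :: "nat \<Rightarrow> 'k orbit \<Rightarrow> 'k FG" where
  "p_gen n \<phi> = var (n, \<phi>)"

text \<open>\<open>p\<^sub>n(f\<^sub>1)\<close> for \<open>f\<^sub>1 = t - 1\<close> and \<open>n \<ge> 1\<close>.\<close>

definition p_f1 :: "nat \<Rightarrow> nat \<Rightarrow> 'k::alg_closed_field FG" where
  "p_f1 q n = cst ((-1) ^ (n - 1) / (of_nat q ^ n - 1)) *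
     (\<Sum>\<phi>\<in>Phi_level q n. of_nat (card \<phi>) * p_gen (n div card \<phi>) \<phi>)"


section \<open>Partitions and Schur functions\<close>

text \<open>A partition is the finite multiset of its positive parts; its length is \<open>size\<close> and its
  weight is \<open>sum_mset\<close>.\<close>

definition is_partition :: "nat multiset \<Rightarrow> bool" where
  "is_partition \<mu> \<longleftrightarrow> 0 \<notin># \<mu>"

definition z_part :: "nat multiset \<Rightarrow> nat" where
  "z_part \<mu> = (\<Prod>i\<in>set_mset \<mu>. i ^ count \<mu> i * fact (count \<mu> i))"

definition p_part :: "nat multiset \<Rightarrow> 'k orbit \<Rightarrow> 'k FG" where
  "p_part \<mu> \<phi> = (\<Prod>i\<in>#\<mu>. p_gen i \<phi>)"

text \<open>Semistandard Young tableaux (lists of rows) with entries below \<open>N\<close>; the row lengths are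
  the parts in decreasing order.\<close>

definition ssyt :: "nat multiset \<Rightarrow> nat \<Rightarrow> nat list list set" where
  "ssyt \<mu> N = {T. map length T = rev (sorted_list_of_multiset \<mu>) \<and>
     (\<forall>r\<in>set T. sorted r \<and> set r \<subseteq> {..<N}) \<and>
     (\<forall>i j. Suc i < length T \<longrightarrow> j < length (T ! Suc i) \<longrightarrow> T ! i ! j < T ! Suc i ! j)}"

definition schur_poly :: "nat multiset \<Rightarrow> nat \<Rightarrow> nat cpoly" where
  "schur_poly \<mu> N = (\<Sum>T\<in>ssyt \<mu> N. prod_list (map var (concat T)))"

definition power_sum_poly :: "nat \<Rightarrow> nat \<Rightarrow> nat cpoly" where
  "power_sum_poly k N = (\<Sum>i<N. var i ^ k)"

text \<open>The Schur function as a polynomial in power sums: the unique polynomial in variables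
  indexed by \<open>k \<ge> 1\<close> which becomes the Schur polynomial in \<open>N\<close> variables, for every \<open>N\<close>, when
  the \<open>k\<close>-th variable is replaced by the \<open>k\<close>-th power sum of those \<open>N\<close> variables.\<close>

definition schur_in_power_sums :: "nat multiset \<Rightarrow> nat cpoly" where
  "schur_in_power_sums \<mu> = (THE P.
     (\<forall>m\<in>Poly_Mapping.keys P. Poly_Mapping.keys m \<subseteq> {1..}) \<and>
     (\<forall>N. subst_poly (\<lambda>k. power_sum_poly k N) P = schur_poly \<mu> N))"

definition schur :: "nat multiset \<Rightarrow> 'k orbit \<Rightarrow> 'k FG" where
  "schur \<mu> \<phi> = subst_poly (\<lambda>k. p_gen k \<phi>) (schur_in_power_sums \<mu>)"


section \<open>Colored partitions\<close>

text \<open>Maps on \<open>Phi q\<close> are made total by the value \<open>{#}\<close> (the empty partition) outside. Products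
  over all \<open>\<phi> \<in> Phi q\<close> are written over the finite support, as all other factors are \<open>1\<close>.\<close>

definition supp :: "('k orbit \<Rightarrow> nat multiset) \<Rightarrow> 'k orbit set" where
  "supp \<Lambda> = {\<phi>. \<Lambda> \<phi> \<noteq> {#}}"

definition colored_partitions :: "nat \<Rightarrow> nat \<Rightarrow> ('k::alg_closed_field orbit \<Rightarrow> nat multiset) set" where
  "colored_partitions q n = {\<Lambda>. supp \<Lambda> \<subseteq> Phi q \<and> finite (supp \<Lambda>) \<and> (\<forall>\<phi>. is_partition (\<Lambda> \<phi>)) \<and>
     (\<Sum>\<phi>\<in>supp \<Lambda>. card \<phi> * sum_mset (\<Lambda> \<phi>)) = n}"

definition Z_colored :: "('k orbit \<Rightarrow> nat multiset) \<Rightarrow> nat" where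
  "Z_colored \<Lambda> = (\<Prod>\<phi>\<in>supp \<Lambda>. z_part (\<Lambda> \<phi>))"

definition p_colored :: "('k orbit \<Rightarrow> nat multiset) \<Rightarrow> 'k FG" where
  "p_colored \<Lambda> = (\<Prod>\<phi>\<in>supp \<Lambda>. p_part (\<Lambda> \<phi>) \<phi>)"

definition schur_colored :: "('k orbit \<Rightarrow> nat multiset) \<Rightarrow> 'k FG" where
  "schur_colored \<Lambda> = (\<Prod>\<phi>\<in>supp \<Lambda>. schur (\<Lambda> \<phi>) \<phi>)"

end

theory Submission
  imports Defs
begin

text \<open>
  Write \<open>H\<^sub>\<phi>(t) = exp (\<Sum>k. p\<^sub>k(\<phi>) t\<^sup>k / k)\<close> for the generating function of the complete symmetric
  functions in the variables attached to an orbit \<open>\<phi>\<close>. Inserting the definition of \<open>p\<^sub>n(f\<^sub>1)\<close>, the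
  factors \<open>1 - q\<^sup>-\<^sup>n\<close> and \<open>q\<^sup>n - 1\<close> cancel up to sign and the power \<open>q\<^sup>-\<^sup>n\<close>, and sorting the exponent by orbits
  turns the series into the product of the \<open>H\<^sub>\<phi>((-z/q)\<^bsup>|\<phi>|\<^esup>)\<close>. The two formulas expand each factor
  in the two classical ways, \<open>h\<^sub>n = \<Sum>\<^sub>\<lambda> p\<^sub>\<lambda> / z\<^sub>\<lambda>\<close> over the partitions of \<open>n\<close>, and
  \<open>h\<^sub>n = s\<^sub>(\<^sub>n\<^sub>)\<close>.

  Infinite products are avoided by working with logarithmic derivatives. The coefficients of an
  exponential \<open>E = exp F\<close> are determined by \<open>E\<^sub>0 = 1\<close> and the recursion
  \<open>n E\<^sub>n = \<Sum>\<^sub>j j F\<^sub>j E\<^bsub>n-j\<^esub>\<close> (\<open>exp_fps_nth_rec\<close>, \<open>newton_recursion_unique\<close>), so it suffices that both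
  right-hand sides satisfy this recursion. Both are sums over finitely supported maps \<open>\<nu>\<close> on a set of
  colors of products \<open>\<Prod>\<^sub>c h c (\<nu> c)\<close>, with \<open>\<Sum>\<^sub>c w c * \<nu> c\<close> prescribed, and \<open>weighted_sum_newton\<close> shows that such a
  sum inherits a recursion from the recursions of the single colors. For the Schur
  expansion the colors are the orbits and \<open>h\<close> gives the complete symmetric functions; for the
  power sum expansion the colors are the pairs of a part and an orbit, and \<open>\<nu>\<close> records
  multiplicities. A third instance, with variables as colors, gives the Newton identity for the
  Schur polynomials of one row; together with the algebraic independence of the power
  sums (\<open>power_sums_algebraically_independent\<close>) it identifies the Schur function of one row as a polynomial in the
  power sums (\<open>schur_in_power_sums_row\<close>).

  All sums have to be finite, which is where the orbits themselves matter: a character of level \<open>n\<close> is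
  fixed by the \<open>n\<close>-th power of Frobenius, so orbits are finite, and conversely a character fixed by
  that power factors through the norm to level \<open>n\<close>, so only finitely many orbits have a size
  dividing \<open>n\<close> (\<open>finite_Phi_level\<close>).
\<close>

section \<open>Exponentials over a polynomial algebra\<close>

lemma cst_zero: "cst 0 = 0"
  by (simp add: cst_def)

lemma cst_one: "cst 1 = 1"
  by (simp add: cst_def)

lemma cst_add: "cst (a + b) = cst a + cst b"
  by (simp add: cst_def single_add)

lemma cst_mult: "cst (a * b) = cst a * cst b"
  by (simp add: cst_def mult_single)

lemma cst_uminus: "cst (- a) = - cst a"
  by (simp add: cst_def single_uminus)

lemma cst_of_nat: "cst (of_nat n) = of_nat n"
  by (simp add: cst_def)

lemma cst_prod: "cst (prod f S) = (\<Prod>x\<in>S. cst (f x))"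
  by (induction S rule: infinite_finite_induct) (simp_all add: cst_one cst_mult)

lemma cst_inverse_prod: "cst (1 / of_nat (prod f S)) = (\<Prod>x\<in>S. cst (1 / of_nat (f x)))"
  by (simp add: prod_dividef flip: cst_prod)

lemma of_nat_cancel_cpoly:
  fixes P Q :: "'v cpoly"
  assumes "0 < n" and "of_nat n * P = of_nat n * Q"
  shows "P = Q"
proof -
  have "cst (1 / of_nat n) * (of_nat n * R) = R" for R :: "'v cpoly"
    using assms(1) by (simp add: cst_of_nat [symmetric] mult.assoc [symmetric] cst_mult [symmetric] cst_one)
  with assms(2) show ?thesis by metis
qed

text \<open>The differential equation \<open>E' = F' E\<close> of \<open>E = exp F\<close>, compared coefficient by coefficient;
  it comes from differentiating the terms \<open>F\<^sup>i / i!\<close> of the exponential.\<close>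

lemma exp_fps_nth_rec:
  assumes "F $ 0 = 0"
  shows "of_nat n * exp_fps F $ n = (\<Sum>j=1..n. of_nat j * F $ j * exp_fps F $ (n - j))"
proof (cases n)
  case 0
  then show ?thesis by simp
next
  case (Suc m)
  let ?E = "exp_fps F"
  \<comment> \<open>Powers beyond the \<open>r\<close>-th vanish in degree \<open>r\<close>, so one summation range serves all coefficients up to \<open>N\<close>.\<close>
  have nth: "?E $ r = (\<Sum>i\<le>N. cst (1 / fact i) * F ^ i $ r)" if "r \<le> N" for r N
    unfolding exp_fps_def fps_compose_nth
    using that startsby_zero_power_prefix [OF assms]
    by (intro sum.mono_neutral_cong_left) auto
  have coeff: "cst (1 / fact (Suc i)) * of_nat (Suc i) = cst (1 / fact i)" for i
    by (simp only: cst_of_nat [symmetric] cst_mult [symmetric]) (simp del: of_nat_Suc)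
  have "of_nat n * ?E $ n = (\<Sum>i\<le>n. cst (1 / fact i) * fps_deriv (F ^ i) $ m)"
    by (simp only: nth [OF order_refl] sum_distrib_left)
      (auto intro!: sum.cong simp: Suc mult_ac fps_deriv_nth)
  also have "\<dots> = (\<Sum>i\<le>m. cst (1 / fact (Suc i)) * fps_deriv (F ^ Suc i) $ m)"
    by (simp only: Suc sum.atMost_Suc_shift) simp
  also have "\<dots> = (\<Sum>i\<le>m. cst (1 / fact i) * (fps_deriv F * F ^ i) $ m)"
  proof (rule sum.cong [OF refl])
    fix i
    have "fps_deriv (F ^ Suc i) $ m = of_nat (Suc i) * (fps_deriv F * F ^ i) $ m"
      by (simp only: fps_deriv_power fps_mult_left_const_nth mult.assoc) simp
    then show "cst (1 / fact (Suc i)) * fps_deriv (F ^ Suc i) $ m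
        = cst (1 / fact i) * (fps_deriv F * F ^ i) $ m"
      by (simp only: mult.assoc [symmetric] coeff)
  qed
  also have "\<dots> = (\<Sum>i\<le>m. \<Sum>j=0..m. fps_deriv F $ j * (cst (1 / fact i) * F ^ i $ (m - j)))"
    by (simp add: fps_mult_nth sum_distrib_left mult_ac del: fps_deriv_nth)
  also have "\<dots> = (\<Sum>j=0..m. fps_deriv F $ j * ?E $ (m - j))"
    by (subst sum.swap) (simp add: nth [of _ m] sum_distrib_left del: fps_deriv_nth)
  also have "\<dots> = (\<Sum>j=1..n. of_nat j * F $ j * ?E $ (n - j))"
    by (rule sum.reindex_bij_witness [of _ "\<lambda>j. j - 1" Suc]) (auto simp: Suc)
  finally show ?thesis .
qed

text \<open>As positive integers can be cancelled, the recursion determines each coefficient from the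
  earlier ones.\<close>

lemma newton_recursion_unique:
  fixes E H :: "nat \<Rightarrow> 'v cpoly"
  assumes "E 0 = H 0"
    and E: "\<And>n. of_nat n * E n = (\<Sum>j=1..n. a j * E (n - j))"
    and H: "\<And>n. of_nat n * H n = (\<Sum>j=1..n. a j * H (n - j))"
  shows "E n = H n"
proof (induction n rule: less_induct)
  case (less n)
  show ?case
  proof (cases "n = 0")
    case False
    have "of_nat n * E n = of_nat n * H n"
      unfolding E H using less by (intro sum.cong) auto
    then show ?thesis
      using False of_nat_cancel_cpoly [of n "E n" "H n"] by simp
  qed (use assms(1) in simp)
qed

section \<open>Newton recursion for sums over finitely supported maps\<close>

definition weighted_maps :: "'c set \<Rightarrow> ('c \<Rightarrow> nat) \<Rightarrow> nat \<Rightarrow> ('c \<Rightarrow>\<^sub>0 nat) set" where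
  "weighted_maps I w n = {\<nu>. Poly_Mapping.keys \<nu> \<subseteq> I \<and>
     (\<Sum>c\<in>Poly_Mapping.keys \<nu>. w c * Poly_Mapping.lookup \<nu> c) = n}"

text \<open>For colors \<open>c\<close> in \<open>I\<close> this is the coefficient of \<open>z ^ n\<close> in the product over \<open>c\<close> of the series
  \<open>\<Sum>i. h c i * z ^ (w c * i)\<close>, provided that \<open>h c 0 = 1\<close>.\<close>

definition weighted_sum :: "'c set \<Rightarrow> ('c \<Rightarrow> nat) \<Rightarrow> ('c \<Rightarrow> nat \<Rightarrow> 'a::comm_semiring_1) \<Rightarrow> nat \<Rightarrow> 'a" where
  "weighted_sum I w h n = (\<Sum>\<nu>\<in>weighted_maps I w n.
     \<Prod>c\<in>Poly_Mapping.keys \<nu>. h c (Poly_Mapping.lookup \<nu> c))"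

lemma weight_superset:
  assumes "finite S" "Poly_Mapping.keys \<nu> \<subseteq> S"
  shows "(\<Sum>c\<in>Poly_Mapping.keys \<nu>. w c * Poly_Mapping.lookup \<nu> c) = (\<Sum>c\<in>S. w c * Poly_Mapping.lookup \<nu> c :: nat)"
  using assms by (intro sum.mono_neutral_left) (auto simp: in_keys_iff)

lemma keys_add_nat:
  "Poly_Mapping.keys (\<mu> + \<nu> :: 'c \<Rightarrow>\<^sub>0 nat) = Poly_Mapping.keys \<mu> \<union> Poly_Mapping.keys \<nu>"
  by (auto simp: in_keys_iff lookup_add)

lemma weight_add:
  "(\<Sum>c\<in>Poly_Mapping.keys (\<mu> + \<nu>). w c * Poly_Mapping.lookup (\<mu> + \<nu>) c) =
   (\<Sum>c\<in>Poly_Mapping.keys \<mu>. w c * Poly_Mapping.lookup \<mu> c) +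
   (\<Sum>c\<in>Poly_Mapping.keys \<nu>. w c * Poly_Mapping.lookup \<nu> c :: nat)"
proof -
  let ?S = "Poly_Mapping.keys \<mu> \<union> Poly_Mapping.keys \<nu>"
  show ?thesis
    using weight_superset [of ?S "\<mu> + \<nu>" w] weight_superset [of ?S \<mu> w] weight_superset [of ?S \<nu> w]
    by (simp add: keys_add_nat lookup_add distrib_left sum.distrib)
qed

text \<open>Adding or removing \<open>k\<close> units of one color is the bijection behind the recursion below.\<close>

lemma weighted_maps_add_single:
  assumes "c \<in> I" "0 < k"
  shows "\<nu> + Poly_Mapping.single c k \<in> weighted_maps I w n \<longleftrightarrow>
    k * w c \<le> n \<and> \<nu> \<in> weighted_maps I w (n - k * w c)"
proof -
  have "Poly_Mapping.keys (\<nu> + Poly_Mapping.single c k) \<subseteq> I \<longleftrightarrow> Poly_Mapping.keys \<nu> \<subseteq> I"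
    using assms by (simp add: keys_add_nat)
  then show ?thesis
    using assms by (auto simp: weighted_maps_def weight_add mult.commute)
qed

lemma finite_small_weight:
  assumes "\<And>c. c \<in> I \<Longrightarrow> 0 < w c" and "\<And>j. 0 < j \<Longrightarrow> finite {c \<in> I. w c dvd j}"
  shows "finite {c \<in> I. w c \<le> (n::nat)}"
proof (rule finite_subset)
  show "{c \<in> I. w c \<le> n} \<subseteq> (\<Union>j\<in>{1..n}. {c \<in> I. w c dvd j})"
  proof
    fix c assume "c \<in> {c \<in> I. w c \<le> n}"
    then show "c \<in> (\<Union>j\<in>{1..n}. {c \<in> I. w c dvd j})"
      using assms(1) [of c] by (intro UN_I [of "w c"]) auto
  qed
  show "finite (\<Union>j\<in>{1..n}. {c \<in> I. w c dvd j})"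
    using assms(2) by auto
qed

text \<open>Only the finitely many colors of weight at most \<open>n\<close> can occur, each with multiplicity at most \<open>n\<close>.\<close>

lemma finite_weighted_maps:
  assumes "\<And>c. c \<in> I \<Longrightarrow> 0 < w c" and "\<And>j. 0 < j \<Longrightarrow> finite {c \<in> I. w c dvd j}"
  shows "finite (weighted_maps I w n)"
proof -
  let ?S = "{c \<in> I. w c \<le> n}"
  let ?F = "{f. \<forall>c. (c \<in> ?S \<longrightarrow> f c \<in> {..n}) \<and> (c \<notin> ?S \<longrightarrow> f c = 0)}"
  have "Poly_Mapping.lookup ` weighted_maps I w n \<subseteq> ?F"
  proof clarify
    fix \<nu> c assume nu: "\<nu> \<in> weighted_maps I w n"
    have "w c * Poly_Mapping.lookup \<nu> c \<le> n" if "c \<in> Poly_Mapping.keys \<nu>"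
      using nu member_le_sum [OF that, of "\<lambda>c. w c * Poly_Mapping.lookup \<nu> c"]
      by (simp add: weighted_maps_def)
    moreover have "0 < w c" if "c \<in> Poly_Mapping.keys \<nu>"
      using nu that assms(1) by (auto simp: weighted_maps_def)
    moreover have "0 < Poly_Mapping.lookup \<nu> c" "c \<in> I" if "c \<in> Poly_Mapping.keys \<nu>"
      using nu that by (auto simp: weighted_maps_def in_keys_iff)
    ultimately have "c \<in> I \<and> w c \<le> n \<and> Poly_Mapping.lookup \<nu> c \<le> n" if "c \<in> Poly_Mapping.keys \<nu>"
      using that mult_le_mono2 [of 1 "Poly_Mapping.lookup \<nu> c" "w c"]
        mult_le_mono1 [of 1 "w c" "Poly_Mapping.lookup \<nu> c"]
      by (metis One_nat_def Suc_leI le_trans mult_1 mult_1_right)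
    then show "(c \<in> ?S \<longrightarrow> Poly_Mapping.lookup \<nu> c \<in> {..n}) \<and>
        (c \<notin> ?S \<longrightarrow> Poly_Mapping.lookup \<nu> c = 0)"
      by (cases "c \<in> Poly_Mapping.keys \<nu>") (auto simp: in_keys_iff)
  qed
  moreover have "finite ?F"
    by (intro finite_set_of_finite_funs finite_small_weight assms) auto
  ultimately have "finite (Poly_Mapping.lookup ` weighted_maps I w n)"
    by (rule finite_subset)
  then show ?thesis
    by (rule finite_imageD) (simp add: inj_on_def)
qed

lemma weighted_sum_0:
  assumes "\<And>c. c \<in> I \<Longrightarrow> 0 < w c"
  shows "weighted_sum I w h 0 = 1"
proof -
  have "\<nu> = 0" if "\<nu> \<in> weighted_maps I w 0" for \<nu>
  proof (rule ccontr)
    assume "\<nu> \<noteq> 0"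
    then obtain c where "c \<in> Poly_Mapping.keys \<nu>"
      by (metis poly_mapping_eqI in_keys_iff lookup_zero)
    moreover have "w c \<noteq> 0" if "c \<in> Poly_Mapping.keys \<nu>" for c
      using \<open>\<nu> \<in> _\<close> assms that by (force simp: weighted_maps_def)
    ultimately show False
      using \<open>\<nu> \<in> _\<close> by (auto simp: weighted_maps_def in_keys_iff)
  qed
  moreover have "0 \<in> weighted_maps I w 0"
    by (simp add: weighted_maps_def)
  ultimately have "weighted_maps I w 0 = {0}" by blast
  then show ?thesis by (simp add: weighted_sum_def)
qed

text \<open>If each series \<open>h c\<close> has logarithmic derivative given by the \<open>p c k\<close>, then the product has
  logarithmic derivative given by the sum of these. Combinatorially: the factor \<open>n\<close> is the total
  weight of \<open>\<nu>\<close>, so it marks a color \<open>c\<close> together with its multiplicity; the recursion for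
  \<open>h c\<close> then splits off \<open>k\<close> units of that color, and what is left is an arbitrary map of weight
  \<open>n - k * w c\<close> together with the data \<open>c\<close> and \<open>k\<close>.\<close>

lemma weighted_sum_newton:
  fixes h p :: "'c \<Rightarrow> nat \<Rightarrow> 'a::comm_semiring_1"
  assumes pos: "\<And>c. c \<in> I \<Longrightarrow> 0 < w c"
    and fin: "\<And>j. 0 < j \<Longrightarrow> finite {c \<in> I. w c dvd j}"
    and h0: "\<And>c. c \<in> I \<Longrightarrow> h c 0 = 1"
    and newton: "\<And>c i. c \<in> I \<Longrightarrow> of_nat i * h c i = (\<Sum>k=1..i. p c k * h c (i - k))"
  shows "of_nat n * weighted_sum I w h n =
    (\<Sum>j=1..n. (\<Sum>c\<in>{c \<in> I. w c dvd j}. of_nat (w c) * p c (j div w c)) * weighted_sum I w h (n - j))"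
proof -
  define V where "V = weighted_maps I w"
  define A where "A \<nu> = (\<Prod>c\<in>Poly_Mapping.keys \<nu>. h c (Poly_Mapping.lookup \<nu> c))" for \<nu>
  have H: "weighted_sum I w h n = sum A (V n)" for n
    by (simp add: weighted_sum_def V_def A_def)
  have finV: "finite (V n)" for n
    unfolding V_def using pos fin by (rule finite_weighted_maps)
  have marked: "of_nat n * A \<nu> =
      (\<Sum>c\<in>Poly_Mapping.keys \<nu>. \<Sum>k=1..Poly_Mapping.lookup \<nu> c.
         of_nat (w c) * p c k * A (\<nu> - Poly_Mapping.single c k))"
    if nu: "\<nu> \<in> V n" for \<nu>
  proof -
    have I: "c \<in> I" if "c \<in> Poly_Mapping.keys \<nu>" for c
      using nu that by (auto simp: V_def weighted_maps_def)
    have "of_nat (w c * Poly_Mapping.lookup \<nu> c) * A \<nu> =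
        (\<Sum>k=1..Poly_Mapping.lookup \<nu> c. of_nat (w c) * p c k * A (\<nu> - Poly_Mapping.single c k))"
      if c: "c \<in> Poly_Mapping.keys \<nu>" for c
    proof -
      let ?R = "\<Prod>d\<in>Poly_Mapping.keys \<nu> - {c}. h d (Poly_Mapping.lookup \<nu> d)"
      have A: "A (\<nu> - Poly_Mapping.single c k) = h c (Poly_Mapping.lookup \<nu> c - k) * ?R" for k
      proof -
        have "A (\<nu> - Poly_Mapping.single c k) =
          (\<Prod>d\<in>Poly_Mapping.keys \<nu>. h d (Poly_Mapping.lookup (\<nu> - Poly_Mapping.single c k) d))"
          unfolding A_def using h0 [OF I]
          by (intro prod.mono_neutral_left) (auto simp: in_keys_iff lookup_minus)
        also have "\<dots> = h c (Poly_Mapping.lookup \<nu> c - k) * ?R"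
        proof (subst prod.remove [OF _ c])
          have "(\<Prod>d\<in>Poly_Mapping.keys \<nu> - {c}. h d (Poly_Mapping.lookup (\<nu> - Poly_Mapping.single c k) d)) = ?R"
            by (rule prod.cong) (auto simp: lookup_minus lookup_single when_def)
          then show "h c (Poly_Mapping.lookup (\<nu> - Poly_Mapping.single c k) c) *
              (\<Prod>d\<in>Poly_Mapping.keys \<nu> - {c}. h d (Poly_Mapping.lookup (\<nu> - Poly_Mapping.single c k) d)) =
              h c (Poly_Mapping.lookup \<nu> c - k) * ?R"
            by (simp add: lookup_minus)
        qed simp
        finally show ?thesis .
      qed
      have "A \<nu> = h c (Poly_Mapping.lookup \<nu> c) * ?R"
        unfolding A_def using c by (simp add: prod.remove)
      then have "of_nat (w c * Poly_Mapping.lookup \<nu> c) * A \<nu> =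
          of_nat (w c) * (of_nat (Poly_Mapping.lookup \<nu> c) * h c (Poly_Mapping.lookup \<nu> c)) * ?R"
        by (simp add: mult_ac)
      also have "\<dots> = (\<Sum>k=1..Poly_Mapping.lookup \<nu> c.
          of_nat (w c) * p c k * (h c (Poly_Mapping.lookup \<nu> c - k) * ?R))"
        by (simp only: newton [OF I [OF c]] sum_distrib_left sum_distrib_right mult.assoc)
      finally show ?thesis by (simp add: A)
    qed
    moreover have "n = (\<Sum>c\<in>Poly_Mapping.keys \<nu>. w c * Poly_Mapping.lookup \<nu> c)"
      using nu by (simp add: V_def weighted_maps_def)
    ultimately show ?thesis
      by (simp only: of_nat_sum sum_distrib_right) (simp cong: sum.cong)
  qed
  have "of_nat n * weighted_sum I w h n =
      (\<Sum>\<nu>\<in>V n. \<Sum>(c, k)\<in>(SIGMA c:Poly_Mapping.keys \<nu>. {1..Poly_Mapping.lookup \<nu> c}).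
         of_nat (w c) * p c k * A (\<nu> - Poly_Mapping.single c k))"
    by (simp add: H sum_distrib_left marked sum.Sigma)
  also have "\<dots> = (\<Sum>(\<nu>, c, k)\<in>(SIGMA \<nu>:V n. SIGMA c:Poly_Mapping.keys \<nu>. {1..Poly_Mapping.lookup \<nu> c}).
         of_nat (w c) * p c k * A (\<nu> - Poly_Mapping.single c k))"
    using finV by (subst sum.Sigma) (auto simp: split_def intro!: finite_SigmaI)
  \<comment> \<open>Triples \<open>(\<nu>, c, k)\<close> with \<open>k\<close> marked units of color \<open>c\<close> correspond to triples \<open>(j, c, \<nu>')\<close>,
    where \<open>j = k * w c\<close> is the weight removed and \<open>\<nu>'\<close> is what remains.\<close>
  also have "\<dots> = (\<Sum>(j, c, \<nu>)\<in>(SIGMA j:{1..n}. {c \<in> I. w c dvd j} \<times> V (n - j)).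
         of_nat (w c) * p c (j div w c) * A \<nu>)"
  proof (rule sum.reindex_bij_witness
      [of _ "\<lambda>(j, c, \<nu>). (\<nu> + Poly_Mapping.single c (j div w c), c, j div w c)"
            "\<lambda>(\<nu>, c, k). (k * w c, c, \<nu> - Poly_Mapping.single c k)"], goal_cases)
    case (1 t)
    then obtain \<nu> c k where t: "t = (\<nu>, c, k)" and nu: "\<nu> \<in> V n"
      and c: "c \<in> Poly_Mapping.keys \<nu>" and k: "1 \<le> k" "k \<le> Poly_Mapping.lookup \<nu> c" by auto
    have "c \<in> I" using nu c by (auto simp: V_def weighted_maps_def)
    moreover have "\<nu> - Poly_Mapping.single c k + Poly_Mapping.single c k = \<nu>"
      using k by (intro poly_mapping_eqI) (auto simp: lookup_add lookup_minus lookup_single when_def)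
    ultimately show ?case using t pos k by auto
  next
    case (2 t)
    then obtain \<nu> c k where t: "t = (\<nu>, c, k)" and nu: "\<nu> \<in> V n"
      and c: "c \<in> Poly_Mapping.keys \<nu>" and k: "1 \<le> k" "k \<le> Poly_Mapping.lookup \<nu> c" by auto
    have I: "c \<in> I" using nu c by (auto simp: V_def weighted_maps_def)
    have "\<nu> - Poly_Mapping.single c k + Poly_Mapping.single c k = \<nu>"
      using k by (intro poly_mapping_eqI) (auto simp: lookup_add lookup_minus lookup_single when_def)
    with nu have "k * w c \<le> n \<and> \<nu> - Poly_Mapping.single c k \<in> V (n - k * w c)"
      using weighted_maps_add_single [OF I, of k "\<nu> - Poly_Mapping.single c k" w n] k
      by (simp add: V_def)
    with t I k pos show ?case by (auto simp: Suc_le_eq)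
  next
    case (3 t)
    then obtain j c \<nu> where t: "t = (j, c, \<nu>)" and j: "1 \<le> j" "j \<le> n"
      and c: "c \<in> I" "w c dvd j" and nu: "\<nu> \<in> V (n - j)" by auto
    then show ?case by (auto intro!: poly_mapping_eqI simp: lookup_minus lookup_add)
  next
    case (4 t)
    then obtain j c \<nu> where t: "t = (j, c, \<nu>)" and j: "1 \<le> j" "j \<le> n"
      and c: "c \<in> I" "w c dvd j" and nu: "\<nu> \<in> V (n - j)" by auto
    have "0 < j div w c" using c j pos by (auto simp: div_greater_zero_iff dvd_imp_le)
    moreover from this have "\<nu> + Poly_Mapping.single c (j div w c) \<in> V n"
      using weighted_maps_add_single [OF c(1), of "j div w c" \<nu> w n] nu j c by (simp add: V_def)
    ultimately show ?case using t by (auto simp: keys_add_nat lookup_add)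
  next
    case (5 t)
    then obtain \<nu> c k where t: "t = (\<nu>, c, k)" and nu: "\<nu> \<in> V n"
      and c: "c \<in> Poly_Mapping.keys \<nu>" by auto
    then have "0 < w c" using pos by (auto simp: V_def weighted_maps_def)
    then show ?case using t by simp
  qed
  also have "\<dots> = (\<Sum>j=1..n. \<Sum>(c, \<nu>)\<in>{c \<in> I. w c dvd j} \<times> V (n - j).
      of_nat (w c) * p c (j div w c) * A \<nu>)"
    using fin finV by (subst sum.Sigma) (auto simp: split_def)
  also have "\<dots> = (\<Sum>j=1..n. (\<Sum>c\<in>{c \<in> I. w c dvd j}. of_nat (w c) * p c (j div w c)) *
      weighted_sum I w h (n - j))"
    by (simp add: H sum_product sum.cartesian_product)
  finally show ?thesis .
qed

section \<open>Evaluation homomorphisms between polynomial algebras\<close>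

text \<open>The subalgebra generated by the variables in \<open>S\<close>.\<close>

definition polys_in :: "'v set \<Rightarrow> 'v cpoly set" where
  "polys_in S = {P. \<forall>m\<in>Poly_Mapping.keys P. Poly_Mapping.keys m \<subseteq> S}"

lemma polys_in_cst: "cst c \<in> polys_in S"
  by (auto simp: polys_in_def cst_def)

lemma polys_in_var: "v \<in> S \<Longrightarrow> var v \<in> polys_in S"
  by (auto simp: polys_in_def var_def)

lemma polys_in_add: "P \<in> polys_in S \<Longrightarrow> Q \<in> polys_in S \<Longrightarrow> P + Q \<in> polys_in S"
  using keys_add [of P Q] by (auto simp: polys_in_def)

lemma polys_in_mult: "P \<in> polys_in S \<Longrightarrow> Q \<in> polys_in S \<Longrightarrow> P * Q \<in> polys_in S"
  using keys_mult [of P Q] by (fastforce simp: polys_in_def keys_add_nat)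

lemma polys_in_diff: "P \<in> polys_in S \<Longrightarrow> Q \<in> polys_in S \<Longrightarrow> P - Q \<in> polys_in S"
  using polys_in_add [of P S "cst (- 1) * Q"] polys_in_mult [OF polys_in_cst, of Q S "- 1"]
  by (simp add: cst_uminus cst_one)

lemma polys_in_sum: "(\<And>x. x \<in> X \<Longrightarrow> f x \<in> polys_in S) \<Longrightarrow> sum f X \<in> polys_in S"
  by (induction X rule: infinite_finite_induct)
    (auto intro: polys_in_add polys_in_cst [of 0, unfolded cst_zero])

lemma polys_in_prod: "(\<And>x. x \<in> X \<Longrightarrow> f x \<in> polys_in S) \<Longrightarrow> prod f X \<in> polys_in S"
  by (induction X rule: infinite_finite_induct)
    (auto intro: polys_in_mult polys_in_cst [of 1, unfolded cst_one])

lemma polys_in_power: "P \<in> polys_in S \<Longrightarrow> P ^ k \<in> polys_in S"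
  by (induction k) (auto intro: polys_in_mult polys_in_cst [of 1, unfolded cst_one])

definition monom_eval :: "('v \<Rightarrow> 'a) \<Rightarrow> ('v \<Rightarrow>\<^sub>0 nat) \<Rightarrow> 'a::comm_semiring_1" where
  "monom_eval f m = (\<Prod>v\<in>Poly_Mapping.keys m. f v ^ Poly_Mapping.lookup m v)"

text \<open>Allowing extra variables of exponent zero makes it possible to compare different monomials over a common
  set of variables; \<open>subst_poly_superset\<close> serves the same purpose for sums over monomials.\<close>

lemma monom_eval_superset:
  assumes "finite S" "Poly_Mapping.keys m \<subseteq> S"
  shows "monom_eval f m = (\<Prod>v\<in>S. f v ^ Poly_Mapping.lookup m v)"
  unfolding monom_eval_def using assms
  by (intro prod.mono_neutral_left) (auto simp: in_keys_iff)

lemma monom_eval_add: "monom_eval f (m + m') = monom_eval f m * monom_eval f m'"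
proof -
  let ?S = "Poly_Mapping.keys m \<union> Poly_Mapping.keys m'"
  show ?thesis
    using monom_eval_superset [of ?S "m + m'" f] monom_eval_superset [of ?S m f]
      monom_eval_superset [of ?S m' f]
    by (simp add: keys_add_nat lookup_add power_add prod.distrib)
qed

lemma monom_eval_single: "monom_eval f (Poly_Mapping.single v k) = f v ^ k"
  by (simp add: monom_eval_def)

lemma monom_eval_zero: "monom_eval f 0 = 1"
  by (simp add: monom_eval_def)

lemma monom_eval_sum: "monom_eval f (sum g X) = (\<Prod>x\<in>X. monom_eval f (g x))"
  by (induction X rule: infinite_finite_induct) (simp_all add: monom_eval_zero monom_eval_add)

lemma monom_eval_var: "monom_eval var m = Poly_Mapping.single m 1"
proof -
  have pow: "var v ^ k = Poly_Mapping.single (Poly_Mapping.single v k) 1" for v :: 'a and k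
    by (induction k) (simp_all add: var_def mult_single flip: single_add)
  have prod: "(\<Prod>v\<in>S. Poly_Mapping.single (g v) (1::complex)) = Poly_Mapping.single (sum g S) 1"
    for S and g :: "'a \<Rightarrow> 'a \<Rightarrow>\<^sub>0 nat"
    by (induction S rule: infinite_finite_induct) (simp_all add: mult_single)
  have "(\<Sum>v\<in>Poly_Mapping.keys m. Poly_Mapping.single v (Poly_Mapping.lookup m v)) = m"
    by (intro poly_mapping_eqI)
      (auto simp: lookup_sum lookup_single when_def in_keys_iff if_distrib sum.delta cong: if_cong)
  then show ?thesis by (simp add: monom_eval_def pow prod)
qed

lemma subst_poly_superset:
  assumes "finite S" "Poly_Mapping.keys P \<subseteq> S"
  shows "subst_poly f P = (\<Sum>m\<in>S. cst (Poly_Mapping.lookup P m) * monom_eval f m)"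
  unfolding subst_poly_def monom_eval_def using assms
  by (intro sum.mono_neutral_left) (auto simp: in_keys_iff cst_zero)

lemma subst_poly_add: "subst_poly f (P + Q) = subst_poly f P + subst_poly f Q"
proof -
  let ?S = "Poly_Mapping.keys P \<union> Poly_Mapping.keys Q"
  show ?thesis
    using keys_add [of P Q] subst_poly_superset [of ?S "P + Q" f] subst_poly_superset [of ?S P f]
      subst_poly_superset [of ?S Q f]
    by (simp add: lookup_add cst_add distrib_right sum.distrib)
qed

lemma subst_poly_zero: "subst_poly f 0 = 0"
  by (simp add: subst_poly_def)

lemma subst_poly_sum: "subst_poly f (sum g X) = (\<Sum>x\<in>X. subst_poly f (g x))"
  by (induction X rule: infinite_finite_induct) (simp_all add: subst_poly_add subst_poly_zero)

lemma subst_poly_single: "subst_poly f (Poly_Mapping.single m c) = cst c * monom_eval f m"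
  by (subst subst_poly_superset [of "{m}"]) auto

lemma subst_poly_cst: "subst_poly f (cst c) = cst c"
  by (subst (1) cst_def) (simp add: subst_poly_single monom_eval_zero)

lemma subst_poly_var: "subst_poly f (var v) = f v"
  by (simp add: var_def subst_poly_single monom_eval_single cst_one)

lemma sum_of_monomials:
  "P = (\<Sum>m\<in>Poly_Mapping.keys P. Poly_Mapping.single m (Poly_Mapping.lookup P m))"
  by (intro poly_mapping_eqI)
    (auto simp: lookup_sum lookup_single when_def in_keys_iff if_distrib sum.delta cong: if_cong)

lemma subst_poly_mult: "subst_poly f (P * Q) = subst_poly f P * subst_poly f Q"
proof -
  let ?s = "\<lambda>R m. Poly_Mapping.single m (Poly_Mapping.lookup R m)"
  have "subst_poly f (P * Q) =
      subst_poly f ((\<Sum>m\<in>Poly_Mapping.keys P. ?s P m) * (\<Sum>m\<in>Poly_Mapping.keys Q. ?s Q m))"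
    by (simp flip: sum_of_monomials)
  also have "\<dots> = (\<Sum>m\<in>Poly_Mapping.keys P. subst_poly f (?s P m)) *
      (\<Sum>m\<in>Poly_Mapping.keys Q. subst_poly f (?s Q m))"
    by (simp add: sum_product subst_poly_sum mult_single subst_poly_single cst_mult monom_eval_add mult_ac)
  also have "\<dots> = subst_poly f P * subst_poly f Q"
    by (simp flip: sum_of_monomials subst_poly_sum)
  finally show ?thesis .
qed

lemma lookup_cst_mult: "Poly_Mapping.lookup (cst c * P) m = c * Poly_Mapping.lookup P m"
  by (simp add: cst_def Poly_Mapping.map.rep_eq when_def flip: mult_map_scale_conv_mult)

section \<open>Algebraic independence of the power sums\<close>

text \<open>The monomial with a given list of factors; listing the factors turns a product of power sums into
  a product over positions, which can be expanded.\<close>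

definition content :: "'v list \<Rightarrow> 'v \<Rightarrow>\<^sub>0 nat" where
  "content xs = (\<Sum>x\<leftarrow>xs. Poly_Mapping.single x 1)"

lemma lookup_content: "Poly_Mapping.lookup (content xs) v = count (mset xs) v"
  by (induction xs) (auto simp: content_def lookup_add lookup_single)

lemma keys_content: "Poly_Mapping.keys (content xs) = set xs"
  by (auto simp: in_keys_iff lookup_content)

lemma monom_eval_content: "monom_eval f (content xs) = prod_list (map f xs)"
  by (induction xs) (simp_all add: content_def monom_eval_zero monom_eval_add monom_eval_single)

lemma content_surj: "\<exists>xs. content xs = m"
proof -
  obtain xs where "mset xs = Abs_multiset (Poly_Mapping.lookup m)" using ex_mset by blast
  then have "content xs = m"
    by (intro poly_mapping_eqI) (simp add: lookup_content)
  then show ?thesis ..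
qed

text \<open>Expanding the product amounts to choosing, for each factor \<open>p\<^bsub>xs ! j\<^esub>\<close>, the index \<open>f j\<close> of the variable whose power is taken.\<close>

lemma lookup_power_sum_product:
  "Poly_Mapping.lookup (monom_eval (\<lambda>k. power_sum_poly k N) (content xs)) t =
   of_nat (card {f \<in> {0..<length xs} \<rightarrow>\<^sub>E {..<N}.
     (\<Sum>j=0..<length xs. Poly_Mapping.single (f j) (xs ! j)) = t})"
proof -
  let ?F = "{0..<length xs} \<rightarrow>\<^sub>E {..<N}"
  let ?m = "\<lambda>f. \<Sum>j=0..<length xs. Poly_Mapping.single (f j) (xs ! j)"
  have fin: "finite ?F" by (intro finite_PiE) auto
  have "monom_eval (\<lambda>k. power_sum_poly k N) (content xs) =
      (\<Prod>j=0..<length xs. \<Sum>i<N. var i ^ (xs ! j))"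
    by (simp add: monom_eval_content prod.list_conv_set_nth power_sum_poly_def)
  also have "\<dots> = (\<Sum>f\<in>?F. \<Prod>j=0..<length xs. var (f j) ^ (xs ! j))"
    by (rule prod_sum_PiE) auto
  also have "\<dots> = (\<Sum>f\<in>?F. Poly_Mapping.single (?m f) 1)"
    by (simp add: monom_eval_sum monom_eval_single flip: monom_eval_var)
  finally show ?thesis
    using fin by (simp add: lookup_sum lookup_single when_def sum.If_cases Int_def)
qed

text \<open>The entries of \<open>ys\<close> are the sums of \<open>xs\<close> over the fibres of \<open>f\<close>. As they are positive, every fibre is
  inhabited, and as \<open>xs\<close> is not longer than \<open>ys\<close>, every fibre is a singleton.\<close>

lemma block_sums_bijective:
  fixes xs ys :: "nat list"
  assumes pos: "\<And>y. y \<in> set ys \<Longrightarrow> 0 < y" and len: "length xs \<le> length ys"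
    and f: "f \<in> {0..<length xs} \<rightarrow> {..<length ys}"
    and eq: "(\<Sum>j=0..<length xs. Poly_Mapping.single (f j) (xs ! j)) =
             (\<Sum>i=0..<length ys. Poly_Mapping.single i (ys ! i))"
  shows "content xs = content ys"
proof -
  let ?X = "{0..<length xs}" and ?Y = "{0..<length ys}"
  have block: "(\<Sum>j\<in>?X. if f j = i then xs ! j else 0) = ys ! i" if "i \<in> ?Y" for i
    using arg_cong [OF eq, of "\<lambda>m. Poly_Mapping.lookup m i"] that
    by (simp add: lookup_sum lookup_single when_def)
  have "?Y \<subseteq> f ` ?X"
  proof
    fix i assume i: "i \<in> ?Y"
    show "i \<in> f ` ?X"
    proof (rule ccontr)
      assume "i \<notin> f ` ?X"
      then have "(\<Sum>j\<in>?X. if f j = i then xs ! j else 0) = 0" by (intro sum.neutral) auto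
      then show False using block [OF i] pos [OF nth_mem, of i] i by simp
    qed
  qed
  then have image: "f ` ?X = ?Y" using f by fastforce
  then have inj: "inj_on f ?X"
    using len card_image_le [of ?X f] by (intro eq_card_imp_inj_on) auto
  have part: "xs ! j = ys ! f j" if j: "j \<in> ?X" for j
  proof -
    have "(\<Sum>j'\<in>?X. if f j' = f j then xs ! j' else 0) = (\<Sum>j'\<in>?X. if j' = j then xs ! j' else 0)"
      using inj j by (intro sum.cong) (auto simp: inj_on_def)
    moreover have "f j \<in> ?Y" using image j by blast
    ultimately show ?thesis using block [of "f j"] j by simp
  qed
  have "content xs = (\<Sum>j\<in>?X. Poly_Mapping.single (ys ! f j) 1)"
    using part by (simp add: content_def sum_list_sum_nth)
  also have "\<dots> = (\<Sum>i\<in>?Y. Poly_Mapping.single (ys ! i) 1)"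
    using inj image by (intro sum.reindex_bij_betw [of f]) (auto simp: bij_betw_def)
  also have "\<dots> = content ys"
    by (simp add: content_def sum_list_sum_nth)
  finally show ?thesis .
qed

text \<open>Among the monomials of \<open>D\<close>, choose one with the largest number of factors, say \<open>ys\<close>, and use as
  many variables as it has factors. The monomial whose exponents are the entries of \<open>ys\<close> occurs in the
  product of power sums for \<open>ys\<close>, and by \<open>block_sums_bijective\<close> in no other product that
  belongs to \<open>D\<close>. Hence its coefficient after substitution is a positive multiple of a nonzero coefficient of \<open>D\<close>.\<close>

lemma power_sums_algebraically_independent:
  assumes D: "D \<in> polys_in {1..}"
    and vanish: "\<And>N. subst_poly (\<lambda>k. power_sum_poly k N) D = 0"
  shows "D = 0"
proof (rule ccontr)
  assume "D \<noteq> 0"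
  then have nonempty: "Poly_Mapping.keys D \<noteq> {}"
    by (metis sum_of_monomials sum.empty)
  obtain L :: "(nat \<Rightarrow>\<^sub>0 nat) \<Rightarrow> nat list" where L: "\<And>m. content (L m) = m"
    using content_surj by metis
  have "Max ((length \<circ> L) ` Poly_Mapping.keys D) \<in> (length \<circ> L) ` Poly_Mapping.keys D"
    using nonempty by (intro Max_in) auto
  then obtain m0 where m0: "m0 \<in> Poly_Mapping.keys D"
    and max: "Max ((length \<circ> L) ` Poly_Mapping.keys D) = length (L m0)" by auto
  have longest: "length (L m) \<le> length (L m0)" if "m \<in> Poly_Mapping.keys D" for m
    using that unfolding max [symmetric] by (intro Max_ge) auto
  let ?N = "length (L m0)"
  define t where "t = (\<Sum>i=0..<?N. Poly_Mapping.single i (L m0 ! i))"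
  define C where "C m = {f \<in> {0..<length (L m)} \<rightarrow>\<^sub>E {..<?N}.
    (\<Sum>j=0..<length (L m). Poly_Mapping.single (f j) (L m ! j)) = t}" for m
  have pos: "0 < y" if "y \<in> set (L m0)" for y
    using D m0 that L [of m0] keys_content [of "L m0"] by (fastforce simp: polys_in_def)
  have other: "C m = {}" if m: "m \<in> Poly_Mapping.keys D" "m \<noteq> m0" for m
  proof (rule ccontr)
    assume "C m \<noteq> {}"
    then have "content (L m) = content (L m0)"
      using block_sums_bijective [OF pos longest [OF m(1)]] by (fastforce simp: C_def t_def PiE_def)
    then show False using m L by metis
  qed
  have "restrict id {0..<?N} \<in> C m0"
    by (auto simp: C_def t_def)
  moreover have "finite ({0..<?N} \<rightarrow>\<^sub>E {..<?N})"
    by (intro finite_PiE) auto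
  then have "finite (C m0)"
    by (rule rev_finite_subset) (auto simp: C_def)
  ultimately have "card (C m0) \<noteq> 0" by auto
  have "0 = Poly_Mapping.lookup (subst_poly (\<lambda>k. power_sum_poly k ?N) D) t"
    by (simp add: vanish)
  also have "\<dots> = (\<Sum>m\<in>Poly_Mapping.keys D. Poly_Mapping.lookup D m * of_nat (card (C m)))"
    unfolding C_def
    by (simp add: subst_poly_superset [OF _ order_refl] lookup_sum lookup_cst_mult L
        flip: lookup_power_sum_product)
  also have "\<dots> = Poly_Mapping.lookup D m0 * of_nat (card (C m0))"
    using m0 other by (subst sum.remove [OF _ m0]) (auto intro!: sum.neutral)
  finally show False using m0 \<open>card (C m0) \<noteq> 0\<close> by (simp add: in_keys_iff)
qed

section \<open>Schur functions of one-row partitions\<close>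

text \<open>The empty partition for \<open>n = 0\<close>, as parts are positive.\<close>

definition row :: "nat \<Rightarrow> nat multiset" where
  "row n = (if n = 0 then {#} else {#n#})"

lemma ssyt_row:
  "ssyt (row n) N = (\<lambda>r. if r = [] then [] else [r]) ` {r. length r = n \<and> sorted r \<and> set r \<subseteq> {..<N}}"
proof (cases "n = 0")
  case True
  then show ?thesis by (auto simp: ssyt_def row_def)
next
  case False
  have "map length T = [n] \<longleftrightarrow> (\<exists>r. T = [r] \<and> length r = n)" for T :: "nat list list"
    by (auto simp: map_eq_Cons_conv)
  with False show ?thesis by (auto simp: ssyt_def row_def image_iff) 
qed

text \<open>A tableau of one row is a weakly increasing word, that is, a monomial; so this is the complete
  symmetric polynomial, a weighted sum with the variables as colors.\<close>

lemma schur_poly_row: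
  "schur_poly (row n) N = weighted_sum {..<N} (\<lambda>_. 1) (\<lambda>i k. var i ^ k) n"
proof -
  let ?R = "{r. length r = n \<and> sorted r \<and> set r \<subseteq> {..<N}}"
  have "schur_poly (row n) N = (\<Sum>r\<in>?R. prod_list (map var r))"
    unfolding schur_poly_def ssyt_row
    by (subst sum.reindex) (auto simp: inj_on_def split: if_splits intro!: sum.cong)
  also have "\<dots> = (\<Sum>\<nu>\<in>weighted_maps {..<N} (\<lambda>_. 1) n. monom_eval var \<nu>)"
  proof (rule sum.reindex_bij_witness
      [of _ "\<lambda>\<nu>. sorted_list_of_multiset (Abs_multiset (Poly_Mapping.lookup \<nu>))" content], goal_cases)
    case (1 r)
    have "Abs_multiset (Poly_Mapping.lookup (content r)) = mset r"
      by (intro multiset_eqI) (simp add: lookup_content)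
    then show ?case using 1 by (simp add: sorted_sort_id)
  next
    case (2 r)
    have "(\<Sum>c\<in>set r. count (mset r) c) = length r"
      by (simp add: size_multiset_overloaded_eq flip: size_mset)
    then show ?case
      using 2 by (simp add: weighted_maps_def keys_content lookup_content)
  next
    case (3 \<nu>)
    then show ?case by (intro poly_mapping_eqI) (simp add: lookup_content)
  next
    case (4 \<nu>)
    have "set_mset (Abs_multiset (Poly_Mapping.lookup \<nu>)) = Poly_Mapping.keys \<nu>"
      by (auto simp: in_keys_iff set_mset_def)
    moreover from this have "size (Abs_multiset (Poly_Mapping.lookup \<nu>)) = n"
      using 4 by (simp add: weighted_maps_def size_multiset_overloaded_eq)
    ultimately show ?case
      using 4 by (simp add: weighted_maps_def flip: size_mset set_mset_mset)
  next
    case (5 r)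
    then show ?case by (simp add: monom_eval_content)
  qed
  finally show ?thesis by (simp add: weighted_sum_def monom_eval_def)
qed

text \<open>For one variable \<open>x\<close>, \<open>n x\<^sup>n\<close> is a sum of \<open>n\<close> equal terms \<open>x\<^sup>k x\<^bsup>n-k\<^esup>\<close>; the identity for
  several variables is the recursion for the weighted sum.\<close>

lemma schur_poly_row_newton:
  "of_nat n * schur_poly (row n) N = (\<Sum>j=1..n. power_sum_poly j N * schur_poly (row (n - j)) N)"
proof -
  have one: "of_nat i * var c ^ i = (\<Sum>k=1..i. var c ^ k * var c ^ (i - k))" for i c
    by (simp flip: power_add)
  show ?thesis
    unfolding schur_poly_row
    by (subst weighted_sum_newton [where p = "\<lambda>c k. var c ^ k"])
      (auto simp: one power_sum_poly_def lessThan_def)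
qed

text \<open>The Newton identity, solved for the complete symmetric function.\<close>

fun complete_in_power_sums :: "nat \<Rightarrow> nat cpoly" where
  "complete_in_power_sums 0 = 1"
| "complete_in_power_sums (Suc n) =
     cst (1 / of_nat (Suc n)) * (\<Sum>j\<le>n. var (Suc j) * complete_in_power_sums (n - j))"

lemma complete_in_power_sums_newton:
  "of_nat n * complete_in_power_sums n = (\<Sum>j=1..n. var j * complete_in_power_sums (n - j))"
proof (cases n)
  case (Suc m)
  have "of_nat (Suc m) * (cst (1 / of_nat (Suc m)) * P) = P" for P :: "nat cpoly"
    by (simp only: cst_of_nat [symmetric] mult.assoc [symmetric] cst_mult [symmetric])
      (simp add: cst_one del: of_nat_Suc)
  then have "of_nat n * complete_in_power_sums n = (\<Sum>j\<le>m. var (Suc j) * complete_in_power_sums (m - j))"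
    unfolding Suc complete_in_power_sums.simps by metis
  also have "\<dots> = (\<Sum>j=1..n. var j * complete_in_power_sums (n - j))"
    by (rule sum.reindex_bij_witness [of _ "\<lambda>j. j - 1" Suc]) (auto simp: Suc)
  finally show ?thesis .
qed simp

lemma subst_complete_newton:
  "of_nat n * subst_poly f (complete_in_power_sums n) =
     (\<Sum>j=1..n. f j * subst_poly f (complete_in_power_sums (n - j)))"
  using arg_cong [OF complete_in_power_sums_newton [of n], of "subst_poly f"]
  by (simp add: subst_poly_mult subst_poly_sum subst_poly_var subst_poly_cst flip: cst_of_nat)

lemma complete_in_power_sums_polys_in: "complete_in_power_sums n \<in> polys_in {1..}"
  by (induction n rule: complete_in_power_sums.induct)
    (auto intro!: polys_in_mult polys_in_sum polys_in_cst polys_in_var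
       polys_in_cst [of 1, unfolded cst_one])

text \<open>The Newton identity in every number of variables gives the defining property; algebraic independence
  of the power sums makes the polynomial with this property unique.\<close>

lemma schur_in_power_sums_row: "schur_in_power_sums (row n) = complete_in_power_sums n"
proof -
  have *: "subst_poly (\<lambda>k. power_sum_poly k N) (complete_in_power_sums n) = schur_poly (row n) N" for N
  proof (rule newton_recursion_unique [where a = "\<lambda>j. power_sum_poly j N"
      and E = "\<lambda>n. subst_poly (\<lambda>k. power_sum_poly k N) (complete_in_power_sums n)"
      and H = "\<lambda>n. schur_poly (row n) N"])
    show "subst_poly (\<lambda>k. power_sum_poly k N) (complete_in_power_sums 0) = schur_poly (row 0) N"
      using subst_poly_cst [of _ 1]
      by (simp add: cst_one schur_poly_row weighted_sum_0)
  qed (rule subst_complete_newton schur_poly_row_newton)+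
  show ?thesis
    unfolding schur_in_power_sums_def
  proof (rule the_equality, goal_cases)
    case 1
    show ?case using * complete_in_power_sums_polys_in by (auto simp: polys_in_def)
  next
    case (2 P)
    then have P: "P \<in> polys_in {1..}" by (simp add: polys_in_def)
    have diff: "subst_poly f (P - Q) = subst_poly f P - subst_poly f Q" for f :: "nat \<Rightarrow> nat cpoly" and Q
      using subst_poly_add [of f "P - Q" Q] by (simp add: algebra_simps)
    have "P - complete_in_power_sums n = 0"
    proof (rule power_sums_algebraically_independent)
      show "P - complete_in_power_sums n \<in> polys_in {1..}"
        by (intro polys_in_diff P complete_in_power_sums_polys_in)
      show "subst_poly (\<lambda>k. power_sum_poly k N) (P - complete_in_power_sums n) = 0" for N
        using 2 * [of N] by (simp add: diff)
    qed
    then show ?case by simp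
  qed
qed

lemma schur_row_0: "schur (row 0) \<phi> = 1"
  using subst_poly_cst [of _ 1] by (simp add: schur_def schur_in_power_sums_row cst_one)

lemma schur_row_newton:
  "of_nat n * schur (row n) \<phi> = (\<Sum>j=1..n. p_gen j \<phi> * schur (row (n - j)) \<phi>)"
  unfolding schur_def schur_in_power_sums_row by (rule subst_complete_newton)

section \<open>Norms, characters and their inflations\<close>

text \<open>For positive levels the group consists of roots of unity, so that membership can be tested on exponents alone.\<close>

lemma M_gp_iff:
  assumes "1 < q" "0 < n"
  shows "x \<in> M_gp q n \<longleftrightarrow> x ^ (q ^ n - 1) = 1"
proof (cases "x = 0")
  case True
  have "1 < q ^ n" using assms by (rule one_less_power)
  then show ?thesis using True by (auto simp: M_gp_def zero_power)
next
  case False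
  have "x ^ (q ^ n) = x * x ^ (q ^ n - 1)"
    using assms power_minus_mult [of "q ^ n" x] by (simp add: mult.commute)
  then show ?thesis using False by (auto simp: M_gp_def)
qed

text \<open>The sum of a geometric progression.\<close>

lemma norm_exponent:
  fixes q :: nat
  assumes "1 < q" "0 < m" "m dvd n"
  shows "(q ^ m - 1) * (\<Sum>i<n div m. q ^ (m * i)) = q ^ n - 1"
proof -
  have "int ((q ^ m - 1) * (\<Sum>i<n div m. q ^ (m * i))) = int (q ^ n - 1)"
    using power_diff_1_eq [of "int q ^ m" "n div m"] assms
    by (simp add: of_nat_diff power_mult [symmetric] mult_ac)
  then show ?thesis by (simp only: of_nat_eq_iff)
qed

lemma norm_map_eq_power:
  assumes "1 < q" "0 < m" "m dvd n"
  shows "norm_map q n m x = x ^ ((q ^ n - 1) div (q ^ m - 1))"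
proof -
  have "0 < q ^ m - 1" using one_less_power [of q m] assms by simp
  then have "(q ^ n - 1) div (q ^ m - 1) = (\<Sum>i<n div m. q ^ (m * i))"
    by (metis nonzero_mult_div_cancel_left norm_exponent [OF assms] neq0_conv)
  then show ?thesis by (simp add: norm_map_def power_sum)
qed

lemma pow_minus_one_dvd:
  fixes q :: nat
  assumes "1 < q" "0 < m" "m dvd n"
  shows "(q ^ m - 1) dvd (q ^ n - 1)"
  using norm_exponent [OF assms] by (metis dvd_triv_left)

lemma norm_map_in_M_gp:
  assumes "1 < q" "0 < m" "m dvd n" "0 < n"
  shows "norm_map q n m x \<in> M_gp q m \<longleftrightarrow> x \<in> M_gp q n"
  using assms pow_minus_one_dvd [OF assms(1-3)]
  by (simp add: norm_map_eq_power M_gp_iff power_mult [symmetric] dvd_div_mult_self)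

lemma norm_map_trans:
  assumes "1 < q" "0 < m" "m dvd n" "n dvd N" "0 < N"
  shows "norm_map q n m (norm_map q N n x) = norm_map q N m x"
proof -
  have n: "0 < n" using assms by (auto intro: dvd_pos_nat)
  have "0 < q ^ n - 1" using one_less_power [of q n] n assms by simp
  then have "(q ^ N - 1) div (q ^ n - 1) * ((q ^ n - 1) div (q ^ m - 1)) = (q ^ N - 1) div (q ^ m - 1)"
    using pow_minus_one_dvd [of q m n] pow_minus_one_dvd [of q n N] n assms
    by (simp add: div_mult_div_if_dvd mult.commute)
  then show ?thesis
    using assms n by (simp add: norm_map_eq_power power_mult [symmetric] dvd_trans [of m n N])
qed

text \<open>In an algebraically closed field a preimage under \<open>x \<mapsto> x ^ d\<close> exists, and it lies automatically in the
  group of level \<open>n\<close> by \<open>norm_map_in_M_gp\<close>.\<close>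

lemma norm_map_surj:
  assumes "1 < q" "0 < m" "m dvd n" "0 < n" "y \<in> M_gp q m"
  shows "\<exists>x\<in>M_gp q n. norm_map q n m x = y"
proof -
  let ?d = "(q ^ n - 1) div (q ^ m - 1)"
  have "0 < q ^ n - 1" using one_less_power [of q n] assms by simp
  then have "0 < ?d" using pow_minus_one_dvd [OF assms(1-3)]
    by (metis dvd_div_eq_0_iff neq0_conv)
  then obtain x where "x ^ ?d = y" using nth_root_exists by blast
  then have "norm_map q n m x = y" using assms by (simp add: norm_map_eq_power)
  then show ?thesis using assms norm_map_in_M_gp by blast
qed

lemma M_gp_mult: "x \<in> M_gp q n \<Longrightarrow> y \<in> M_gp q n \<Longrightarrow> x * y \<in> M_gp q n"
  by (simp add: M_gp_def power_mult_distrib)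

lemma M_gp_inverse: "x \<in> M_gp q n \<Longrightarrow> inverse x \<in> M_gp q n"
  by (simp add: M_gp_def power_inverse)

lemma one_in_M_gp: "1 \<in> M_gp q n"
  by (simp add: M_gp_def)

lemma M_gp_power: "x \<in> M_gp q n \<Longrightarrow> x ^ k \<in> M_gp q n"
  by (induction k) (simp_all add: one_in_M_gp M_gp_mult)

lemma norm_map_mult: "norm_map q n m (x * y) = norm_map q n m x * norm_map q n m y"
  by (simp add: norm_map_def power_mult_distrib prod.distrib)

lemma M_dual_one:
  assumes "\<chi> \<in> M_dual q n"
  shows "\<chi> 1 = 1"
proof -
  have "\<chi> (1 * 1) = \<chi> 1 * \<chi> 1" "\<chi> 1 \<noteq> 0"
    using assms one_in_M_gp unfolding M_dual_def by blast+
  then show ?thesis by simp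
qed

lemma M_dual_power:
  assumes "\<chi> \<in> M_dual q n" "x \<in> M_gp q n"
  shows "\<chi> (x ^ k) = \<chi> x ^ k"
proof (induction k)
  case (Suc k)
  have "\<chi> (x * x ^ k) = \<chi> x * \<chi> (x ^ k)"
    using assms M_gp_power [OF assms(2), of k] by (auto simp: M_dual_def)
  with Suc show ?case by simp
qed (use assms M_dual_one in simp)

lemma inflate_in_M_dual:
  assumes "1 < q" "0 < m" "m dvd n" "0 < n" "\<chi> \<in> M_dual q m"
  shows "inflate q m n \<chi> \<in> M_dual q n"
  using assms(5) norm_map_in_M_gp [OF assms(1-4)]
  by (auto simp: M_dual_def inflate_def norm_map_mult M_gp_mult)

lemma inflate_inflate:
  assumes "1 < q" "0 < m" "m dvd n" "n dvd N" "0 < N"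
  shows "inflate q n N (inflate q m n \<chi>) = inflate q m N \<chi>"
proof -
  have "0 < n" using assms by (auto intro: dvd_pos_nat)
  then show ?thesis
    using assms by (auto simp: inflate_def norm_map_trans norm_map_in_M_gp)
qed

lemma inflate_power:
  assumes "0 < k"
  shows "inflate q m n (\<lambda>x. \<chi> x ^ k) = (\<lambda>x. inflate q m n \<chi> x ^ k)"
  using assms by (auto simp: inflate_def)

lemma power_in_M_dual:
  assumes "\<chi> \<in> M_dual q n" "0 < k"
  shows "(\<lambda>x. \<chi> x ^ k) \<in> M_dual q n"
  using assms by (auto simp: M_dual_def power_mult_distrib)

lemma dual_rel_iff:
  "((m, \<chi>), (n, \<psi>)) \<in> dual_rel q \<longleftrightarrow> 0 < m \<and> 0 < n \<and> \<chi> \<in> M_dual q m \<and> \<psi> \<in> M_dual q n \<and>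
     (\<exists>N>0. m dvd N \<and> n dvd N \<and> inflate q m N \<chi> = inflate q n N \<psi>)"
  by (auto simp: dual_rel_def)

text \<open>For transitivity, inflate everything to the product of the two levels at which the given
  identifications take place.\<close>

lemma equiv_dual_rel:
  assumes "1 < q"
  shows "equiv (SIGMA n:{0<..}. M_dual q n) (dual_rel q)"
proof (rule equivI)
  show "dual_rel q \<subseteq> (SIGMA n:{0<..}. M_dual q n) \<times> (SIGMA n:{0<..}. M_dual q n)"
    by (auto simp: dual_rel_def)
  show "refl_on (SIGMA n:{0<..}. M_dual q n) (dual_rel q)"
    by (auto simp: refl_on_def dual_rel_iff)
  show "sym (dual_rel q)"
    by (auto simp: sym_def dual_rel_iff)
  show "trans (dual_rel q)"
  proof (rule transI, clarify)
    fix m \<chi> n \<psi> r \<theta>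
    assume "((m, \<chi>), (n, \<psi>)) \<in> dual_rel q" "((n, \<psi>), (r, \<theta>)) \<in> dual_rel q"
    then obtain N N' where *: "0 < m" "0 < n" "0 < r" "\<chi> \<in> M_dual q m" "\<theta> \<in> M_dual q r"
      "0 < N" "m dvd N" "n dvd N" "inflate q m N \<chi> = inflate q n N \<psi>"
      "0 < N'" "n dvd N'" "r dvd N'" "inflate q n N' \<psi> = inflate q r N' \<theta>"
      by (auto simp: dual_rel_iff)
    let ?L = "N * N'"
    have lift: "inflate q k ?L \<eta> = inflate q M ?L (inflate q k M \<eta>)"
      if "0 < k" "k dvd M" "M = N \<or> M = N'" for k M \<eta>
      by (rule inflate_inflate [symmetric]) (use that assms * in auto)
    have "inflate q m ?L \<chi> = inflate q N ?L (inflate q n N \<psi>)"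
      using lift [of m N \<chi>] * by metis
    also have "\<dots> = inflate q N' ?L (inflate q n N' \<psi>)"
      using lift [of n N \<psi>] lift [of n N' \<psi>] * by metis
    also have "\<dots> = inflate q r ?L \<theta>"
      using lift [of r N' \<theta>] * by metis
    finally show "((m, \<chi>), (r, \<theta>)) \<in> dual_rel q"
      using * by (auto simp: dual_rel_iff intro!: exI [of _ ?L])
  qed
qed

definition mclass :: "nat \<Rightarrow> nat \<Rightarrow> ('k::alg_closed_field \<Rightarrow> complex) \<Rightarrow> 'k mchar" where
  "mclass q n \<chi> = dual_rel q `` {(n, \<chi>)}"

lemma Mstar_eq: "Mstar q = (\<Union>n\<in>{0<..}. mclass q n ` M_dual q n)"
  by (auto simp: Mstar_def quotient_def mclass_def)

lemma frobenius_mclass: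
  assumes "1 < q" "0 < n" "\<chi> \<in> M_dual q n"
  shows "frobenius q (mclass q n \<chi>) = mclass q n (\<lambda>x. \<chi> x ^ q)"
proof -
  let ?S = "{(m, \<lambda>x. \<psi> x ^ q) | m \<psi>. (m, \<psi>) \<in> mclass q n \<chi>}"
  note eq = equiv_dual_rel [OF assms(1)]
  have rel: "((n, \<lambda>x. \<chi> x ^ q), (m, \<lambda>x. \<psi> x ^ q)) \<in> dual_rel q"
    if "((n, \<chi>), (m, \<psi>)) \<in> dual_rel q" for m \<psi>
    using that assms by (auto simp: dual_rel_iff inflate_power power_in_M_dual)
  have "((n, \<chi>), (n, \<chi>)) \<in> dual_rel q"
    using assms by (auto simp: dual_rel_iff)
  then have mem: "(n, \<lambda>x. \<chi> x ^ q) \<in> ?S"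
    by (auto simp: mclass_def)
  have "dual_rel q `` {s} = mclass q n (\<lambda>x. \<chi> x ^ q)" if "s \<in> ?S" for s
    using that rel equiv_class_eq [OF eq] by (fastforce simp: mclass_def)
  then have "dual_rel q `` ?S = mclass q n (\<lambda>x. \<chi> x ^ q)"
    using mem by (subst Image_eq_UN) blast
  then show ?thesis by (simp add: frobenius_def)
qed

lemma frobenius_funpow_mclass:
  assumes "1 < q" "0 < n" "\<chi> \<in> M_dual q n"
  shows "(frobenius q ^^ i) (mclass q n \<chi>) = mclass q n (\<lambda>x. \<chi> x ^ (q ^ i))"
proof (induction i)
  case (Suc i)
  have "(\<lambda>x. \<chi> x ^ (q ^ i)) \<in> M_dual q n"
    using assms by (intro power_in_M_dual) auto
  with Suc assms show ?case
    by (simp add: frobenius_mclass power_mult [symmetric] mult.commute)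
qed simp

text \<open>On the group of level \<open>n\<close> one has \<open>x ^ (q ^ n) = x\<close>, hence the same holds for character values.\<close>

lemma frobenius_periodic:
  assumes "1 < q" "0 < n" "\<chi> \<in> M_dual q n"
  shows "(frobenius q ^^ n) (mclass q n \<chi>) = mclass q n \<chi>"
proof -
  have "\<chi> x ^ (q ^ n) = \<chi> x" for x
  proof (cases "x \<in> M_gp q n")
    case True
    then show ?thesis
      using M_dual_power [OF assms(3) True, of "q ^ n"] by (simp add: M_gp_def)
  next
    case False
    then show ?thesis using assms by (auto simp: M_dual_def)
  qed
  then show ?thesis using frobenius_funpow_mclass [OF assms, of n] by simp
qed

section \<open>Finiteness of the sets of Frobenius orbits\<close>

text \<open>A form of Hilbert 90. The norm is \<open>x \<mapsto> x ^ d\<close> with \<open>d = (q ^ L - 1) div (q ^ n - 1)\<close>, and an element \<open>u\<close> of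
  its kernel is a power \<open>w ^ (q ^ n - 1)\<close> with \<open>w\<close> in the group of level \<open>L\<close>. Since \<open>\<theta>\<close> is its own
  \<open>q ^ n\<close>-th power, \<open>\<theta> u = \<theta> w ^ (q ^ n - 1) = 1\<close>; so \<open>\<theta>\<close> descends along the surjective norm.\<close>

lemma character_factors_through_norm:
  fixes \<theta> :: "'k::alg_closed_field \<Rightarrow> complex"
  assumes q: "1 < q" and n: "0 < n" "n dvd L" "0 < L" and \<theta>: "\<theta> \<in> M_dual q L"
    and fixed: "\<And>x. \<theta> x ^ (q ^ n) = \<theta> x"
  shows "\<exists>\<psi>\<in>M_dual q n. inflate q n L \<psi> = \<theta>"
proof -
  let ?N = "norm_map q L n"
  define \<psi> where "\<psi> y = (if y \<in> M_gp q n then \<theta> (SOME x. x \<in> M_gp q L \<and> ?N x = y) else 0)" for y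
  have mult: "\<theta> (x * y) = \<theta> x * \<theta> y" if "x \<in> M_gp q L" "y \<in> M_gp q L" for x y
    using \<theta> that by (auto simp: M_dual_def)
  have kernel: "\<theta> u = 1" if u: "u \<in> M_gp q L" "?N u = 1" for u
  proof -
    have pos: "0 < q ^ n - 1" using one_less_power [OF q n(1)] by simp
    then obtain w where w: "w ^ (q ^ n - 1) = u" using nth_root_exists by blast
    have "w ^ (q ^ L - 1) = (w ^ (q ^ n - 1)) ^ ((q ^ L - 1) div (q ^ n - 1))"
      using pow_minus_one_dvd [OF q n(1,2)] by (simp add: power_mult [symmetric])
    then have "w ^ (q ^ L - 1) = 1"
      using u(2) by (simp only: w norm_map_eq_power [OF q n(1,2)])
    then have wL: "w \<in> M_gp q L"
      using q n by (simp only: M_gp_iff)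
    then have "\<theta> w \<noteq> 0" using \<theta> by (auto simp: M_dual_def)
    moreover have "\<theta> w * \<theta> w ^ (q ^ n - 1) = \<theta> w"
      using fixed [of w] power_minus_mult [of "q ^ n" "\<theta> w"] q by (simp add: mult.commute)
    ultimately have "\<theta> w ^ (q ^ n - 1) = 1" by simp
    then show ?thesis using M_dual_power [OF \<theta> wL, of "q ^ n - 1"] w by simp
  qed
  have \<psi>: "\<psi> (?N x) = \<theta> x" if x: "x \<in> M_gp q L" for x
  proof -
    define x' where "x' = (SOME x'. x' \<in> M_gp q L \<and> ?N x' = ?N x)"
    have x': "x' \<in> M_gp q L" "?N x' = ?N x"
      unfolding x'_def using someI [of "\<lambda>x'. x' \<in> M_gp q L \<and> ?N x' = ?N x" x] x by auto
    have "x \<noteq> 0" using x by (simp add: M_gp_def)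
    have "?N (x' * inverse x) = 1"
      using x'(2) norm_map_mult [of q L n x "inverse x"] \<open>x \<noteq> 0\<close>
      by (simp add: norm_map_mult) (simp add: norm_map_def)
    then have "\<theta> (x' * inverse x) = 1"
      using x x' by (intro kernel M_gp_mult M_gp_inverse)
    moreover have "\<theta> x' = \<theta> (x' * inverse x) * \<theta> x"
      using mult [of "x' * inverse x" x] x x' \<open>x \<noteq> 0\<close>
      by (simp add: M_gp_mult M_gp_inverse mult.assoc)
    ultimately have "\<theta> x' = \<theta> x" by simp
    moreover have "?N x \<in> M_gp q n" using x norm_map_in_M_gp [OF q n] by blast
    ultimately show ?thesis by (simp add: \<psi>_def x'_def)
  qed
  have "\<psi> \<in> M_dual q n"
    unfolding M_dual_def
  proof (intro CollectI conjI ballI allI impI)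
    fix y :: 'k assume "y \<in> M_gp q n"
    then obtain x where x: "x \<in> M_gp q L" "?N x = y" using norm_map_surj [OF q n] by blast
    then show "\<psi> y \<noteq> 0" using \<psi> \<theta> by (auto simp: M_dual_def)
    fix z :: 'k assume "z \<in> M_gp q n"
    then obtain x' where x': "x' \<in> M_gp q L" "?N x' = z" using norm_map_surj [OF q n] by blast
    have "\<psi> (?N (x * x')) = \<psi> (?N x) * \<psi> (?N x')"
      using x(1) x'(1) by (simp add: \<psi> mult M_gp_mult)
    then show "\<psi> (y * z) = \<psi> y * \<psi> z"
      by (simp add: norm_map_mult x x')
  qed (simp add: \<psi>_def)
  moreover have "inflate q n L \<psi> = \<theta>"
    using \<psi> \<theta> by (auto simp: inflate_def M_dual_def fun_eq_iff)
  ultimately show ?thesis by blast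
qed

text \<open>The equality of classes holds at some level \<open>N\<close>; after inflation to a common multiple of \<open>N\<close> and \<open>n\<close>
  the character is its own \<open>q ^ n\<close>-th power and descends to level \<open>n\<close>.\<close>

lemma frobenius_fixed:
  assumes q: "1 < q" and n: "0 < n" and \<xi>: "\<xi> \<in> Mstar q" and fixed: "(frobenius q ^^ n) \<xi> = \<xi>"
  shows "\<xi> \<in> mclass q n ` M_dual q n"
proof -
  obtain m \<chi> where m: "0 < m" and \<chi>: "\<chi> \<in> M_dual q m" and \<xi>_eq: "\<xi> = mclass q m \<chi>"
    using \<xi> by (auto simp: Mstar_eq)
  note eq = equiv_dual_rel [OF q]
  let ?\<chi>' = "\<lambda>x. \<chi> x ^ (q ^ n)"
  have pos: "0 < q ^ n" using q by simp
  have "mclass q m ?\<chi>' = mclass q m \<chi>"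
    using fixed frobenius_funpow_mclass [OF q m \<chi>] by (simp add: \<xi>_eq)
  then have "((m, ?\<chi>'), (m, \<chi>)) \<in> dual_rel q"
    using m \<chi> power_in_M_dual [OF \<chi> pos]
    by (intro eq_equiv_class [OF _ eq]) (auto simp: mclass_def)
  then obtain N where N: "0 < N" "m dvd N" "inflate q m N ?\<chi>' = inflate q m N \<chi>"
    by (auto simp: dual_rel_iff)
  define L where "L = N * n"
  have L: "0 < L" "m dvd L" "n dvd L" "N dvd L" using N n by (auto simp: L_def)
  define \<theta> where "\<theta> = inflate q m L \<chi>"
  have "inflate q m L ?\<chi>' = \<theta>"
    using N L q m unfolding \<theta>_def by (metis inflate_inflate)
  then have "\<theta> x ^ (q ^ n) = \<theta> x" for x
    unfolding inflate_power [OF pos] by (metis \<theta>_def)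
  moreover have "\<theta> \<in> M_dual q L"
    unfolding \<theta>_def using q m L \<chi> by (intro inflate_in_M_dual)
  ultimately obtain \<psi> where \<psi>: "\<psi> \<in> M_dual q n" "inflate q n L \<psi> = \<theta>"
    using character_factors_through_norm [OF q n L(3,1)] by blast
  have "((m, \<chi>), (n, \<psi>)) \<in> dual_rel q"
    using m n \<chi> \<psi> L by (auto simp: dual_rel_iff \<theta>_def)
  then have "\<xi> = mclass q n \<psi>"
    unfolding \<xi>_eq mclass_def by (rule equiv_class_eq [OF eq])
  then show ?thesis using \<psi> by blast
qed

lemma finite_roots_of_unity:
  assumes "0 < d"
  shows "finite {x :: 'a::idom. x ^ d = 1}"
proof -
  let ?P = "Polynomial.monom 1 d - 1 :: 'a poly"
  have "coeff ?P d = 1" using assms by simp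
  then have "?P \<noteq> 0" by (metis coeff_0 zero_neq_one)
  then have "finite {x. poly ?P x = 0}" by (rule poly_roots_finite)
  then show ?thesis by (simp add: poly_monom)
qed

text \<open>A character takes values in the roots of unity of order dividing \<open>q ^ n - 1\<close> and vanishes
  outside a finite group.\<close>

lemma finite_M_dual:
  assumes "1 < q" "0 < n"
  shows "finite (M_dual q n :: ('k::alg_closed_field \<Rightarrow> complex) set)"
proof -
  have pos: "0 < q ^ n - 1" using one_less_power [OF assms] by simp
  have "(M_gp q n :: 'k set) = {x. x ^ (q ^ n - 1) = 1}"
    using M_gp_iff [OF assms] by blast
  then have fin: "finite (M_gp q n :: 'k set)"
    using finite_roots_of_unity [OF pos] by simp
  have "\<chi> x ^ (q ^ n - 1) = 1" if "\<chi> \<in> M_dual q n" "x \<in> M_gp q n" for \<chi> and x :: 'k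
    using M_dual_power [OF that, of "q ^ n - 1"] that M_gp_iff [OF assms] M_dual_one by metis
  then have "M_dual q n \<subseteq> {\<chi> :: 'k \<Rightarrow> complex. \<forall>x. (x \<in> M_gp q n \<longrightarrow> \<chi> x \<in> {z. z ^ (q ^ n - 1) = 1})
      \<and> (x \<notin> M_gp q n \<longrightarrow> \<chi> x = 0)}"
    by (auto simp: M_dual_def)
  then show ?thesis
    by (rule finite_subset) (intro finite_set_of_finite_funs fin finite_roots_of_unity pos)
qed

text \<open>The size of the orbit of a periodic point is its least period.\<close>

lemma periodic_orbit:
  assumes "0 < n" and "(f ^^ n) x = x"
  shows "finite (range (\<lambda>i. (f ^^ i) x))"
    and "0 < card (range (\<lambda>i. (f ^^ i) x))"
    and "(f ^^ card (range (\<lambda>i. (f ^^ i) x))) x = x"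
proof -
  define d where "d = (LEAST d. 0 < d \<and> (f ^^ d) x = x)"
  have d: "0 < d" "(f ^^ d) x = x"
    using LeastI [of "\<lambda>d. 0 < d \<and> (f ^^ d) x = x" n] assms by (auto simp: d_def)
  have least: "d \<le> k" if "0 < k" "(f ^^ k) x = x" for k
    unfolding d_def using that by (auto intro: Least_le)
  have "(f ^^ i) x = (f ^^ (i mod d)) x" for i
    using d by (simp add: funpow_mod_eq)
  then have range: "range (\<lambda>i. (f ^^ i) x) = (\<lambda>i. (f ^^ i) x) ` {..<d}"
    using d(1) by (force intro: rev_image_eqI [of "_ mod d"])
  have "(f ^^ i) x \<noteq> (f ^^ j) x" if "i < j" "j < d" for i j
  proof
    assume eq: "(f ^^ i) x = (f ^^ j) x"
    have "(f ^^ (d - j + i)) x = (f ^^ (d - j + j)) x"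
      by (simp only: funpow_add o_apply eq)
    then have "(f ^^ (d - j + i)) x = x" using that d by simp
    then show False using least [of "d - j + i"] that by simp
  qed
  then have "inj_on (\<lambda>i. (f ^^ i) x) {..<d}"
    unfolding inj_on_def by (metis lessThan_iff linorder_neqE_nat)
  then have "card (range (\<lambda>i. (f ^^ i) x)) = d"
    unfolding range by (simp add: card_image)
  then show "finite (range (\<lambda>i. (f ^^ i) x))" "0 < card (range (\<lambda>i. (f ^^ i) x))"
    "(f ^^ card (range (\<lambda>i. (f ^^ i) x))) x = x"
    using d range by simp_all
qed

lemma Phi_orbit:
  assumes "1 < q" "\<phi> \<in> Phi q"
  shows "0 < card \<phi>"
    and "\<exists>\<xi>\<in>Mstar q. \<phi> = range (\<lambda>i. (frobenius q ^^ i) \<xi>) \<and> (frobenius q ^^ card \<phi>) \<xi> = \<xi>"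
proof -
  obtain \<xi> where \<xi>: "\<xi> \<in> Mstar q" and \<phi>: "\<phi> = range (\<lambda>i. (frobenius q ^^ i) \<xi>)"
    using assms(2) by (auto simp: Phi_def)
  obtain n \<chi> where "0 < n" "\<chi> \<in> M_dual q n" "\<xi> = mclass q n \<chi>"
    using \<xi> by (auto simp: Mstar_eq)
  then have n: "0 < n" "(frobenius q ^^ n) \<xi> = \<xi>"
    using frobenius_periodic [OF assms(1)] by auto
  show "0 < card \<phi>"
    using periodic_orbit(2) [OF n] \<phi> by simp
  have "(frobenius q ^^ card \<phi>) \<xi> = \<xi>"
    using periodic_orbit(3) [OF n] \<phi> by simp
  with \<xi> \<phi> show "\<exists>\<xi>\<in>Mstar q. \<phi> = range (\<lambda>i. (frobenius q ^^ i) \<xi>) \<and> (frobenius q ^^ card \<phi>) \<xi> = \<xi>"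
    by blast
qed

text \<open>An orbit whose size divides \<open>n\<close> consists of points fixed by the \<open>n\<close>-th power of Frobenius, and by
  \<open>frobenius_fixed\<close> these come from the finitely many characters of level \<open>n\<close>.\<close>

lemma finite_Phi_level:
  assumes "1 < q" "0 < n"
  shows "finite (Phi_level q n)"
proof (rule finite_subset)
  let ?orbit = "\<lambda>\<xi>. range (\<lambda>i. (frobenius q ^^ i) \<xi>)"
  show "finite (?orbit ` mclass q n ` M_dual q n)"
    by (intro finite_imageI finite_M_dual assms)
  show "Phi_level q n \<subseteq> ?orbit ` mclass q n ` M_dual q n"
  proof
    fix \<phi> assume "\<phi> \<in> Phi_level q n"
    then have "\<phi> \<in> Phi q" and dvd: "card \<phi> dvd n"
      by (auto simp: Phi_level_def)
    then obtain \<xi> where \<xi>: "\<xi> \<in> Mstar q" "\<phi> = ?orbit \<xi>" "(frobenius q ^^ card \<phi>) \<xi> = \<xi>"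
      using Phi_orbit(2) [OF assms(1) \<open>\<phi> \<in> Phi q\<close>] by (elim bexE conjE) (rule that)
    then have "(frobenius q ^^ n) \<xi> = \<xi>"
      using funpow_mod_eq [OF \<xi>(3), of n] dvd_imp_mod_0 [OF dvd] by simp
    then show "\<phi> \<in> ?orbit ` mclass q n ` M_dual q n"
      using frobenius_fixed [OF assms \<xi>(1)] \<xi>(2) by blast
  qed
qed

section \<open>Colored partitions as finitely supported maps\<close>

lemma F_G_eq: "F_G q = polys_in ({1..} \<times> Phi q)"
  by (simp add: F_G_def polys_in_def)

text \<open>In the power sum expansion the color \<open>(i, \<phi>)\<close> stands for a part \<open>i\<close> of the partition attached to \<open>\<phi>\<close>.\<close>

definition part_weight :: "nat \<times> 'k orbit \<Rightarrow> nat" where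
  "part_weight = (\<lambda>(i, \<phi>). i * card \<phi>)"

text \<open>The contribution of a part of multiplicity \<open>m\<close> to \<open>p\<^sub>\<lambda> / z\<^sub>\<lambda>\<close>. With \<open>t ^ m\<close> and summed over \<open>m\<close> this is
  \<open>exp (p\<^sub>i(\<phi>) t / i)\<close>, so the logarithmic derivative has a single term.\<close>

definition part_term :: "nat \<times> 'k orbit \<Rightarrow> nat \<Rightarrow> 'k FG" where
  "part_term = (\<lambda>(i, \<phi>) m. cst (1 / of_nat (i ^ m * fact m)) * p_gen i \<phi> ^ m)"

lemma part_term_newton:
  fixes c :: "nat \<times> 'k orbit"
  shows "of_nat m * part_term c m = (\<Sum>k=1..m. (if k = 1 then cst (1 / of_nat (fst c)) * var c else 0) * part_term c (m - k))"
proof (cases m)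
  case (Suc r)
  obtain i \<phi> where c: "c = (i, \<phi>)" by (cases c)
  have "of_nat m * cst (1 / of_nat (i ^ m * fact m)) = (cst (1 / of_nat i) * cst (1 / of_nat (i ^ r * fact r)) :: 'k FG)"
  proof -
    have cancel: "x * (1 / (a * b * (x * d))) = 1 / a * (1 / (b * d))" if "x \<noteq> 0" for x a b d :: complex
      using that by simp
    show ?thesis
      using cancel [OF of_nat_neq_0, of r "of_nat i" "of_nat i ^ r" "fact r"]
      unfolding cst_of_nat [symmetric] cst_mult [symmetric] Suc
      by (simp only: power_Suc fact_Suc of_nat_mult of_nat_power of_nat_fact of_nat_id)
  qed
  then have "of_nat m * part_term c m =
      cst (1 / of_nat i) * cst (1 / of_nat (i ^ r * fact r)) * p_gen i \<phi> ^ m"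
    by (simp only: part_term_def c prod.case mult.assoc [symmetric])
  also have "\<dots> = cst (1 / of_nat (fst c)) * var c * part_term c r"
    by (simp add: part_term_def c p_gen_def Suc mult_ac)
  finally have "of_nat m * part_term c m = cst (1 / of_nat (fst c)) * var c * part_term c r" .
  moreover have "(\<Sum>k=1..m. (if k = 1 then cst (1 / of_nat (fst c)) * var c else 0) * part_term c (m - k))
      = (\<Sum>k=1..m. if k = 1 then cst (1 / of_nat (fst c)) * var c * part_term c (m - 1) else 0)"
    by (rule sum.cong) auto
  ultimately show ?thesis by (simp add: Suc)
qed simp

text \<open>Only colors of weight exactly \<open>j\<close> contribute, and such a color is determined by its orbit, whose
  size must divide \<open>j\<close>; the factor \<open>i\<close> of the weight cancels the \<open>1 / i\<close> from the exponent.\<close>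

lemma power_sum_coeff_parts:
  assumes card_pos: "\<And>\<phi> :: 'k::alg_closed_field orbit. \<phi> \<in> Phi q \<Longrightarrow> 0 < card \<phi>"
    and fin: "finite (Phi_level q j :: 'k orbit set)" and "0 < j"
  shows "finite {c \<in> {1..} \<times> (Phi q :: 'k orbit set). part_weight c dvd j}"
    and "(\<Sum>c\<in>{c \<in> {1..} \<times> (Phi q :: 'k orbit set). part_weight c dvd j}. of_nat (part_weight c) *
            (if j div part_weight c = 1 then cst (1 / of_nat (fst c)) * var c else 0)) =
         (\<Sum>\<phi>\<in>Phi_level q j. of_nat (card \<phi>) * p_gen (j div card \<phi>) \<phi>)"
proof -
  let ?C = "{c \<in> {1..} \<times> (Phi q :: 'k orbit set). part_weight c dvd j}"
  let ?f = "\<lambda>c. of_nat (part_weight c) * (if j div part_weight c = 1 then cst (1 / of_nat (fst c)) * var c else 0)"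
  have "?C \<subseteq> {1..j} \<times> Phi_level q j"
    using \<open>0 < j\<close> by (auto simp: part_weight_def Phi_level_def dest: dvd_mult_left dvd_mult_right intro: dvd_imp_le)
  then show finC: "finite ?C"
    by (rule finite_subset) (use fin in auto)
  have exact: "part_weight c = j" if "c \<in> ?C" "j div part_weight c = 1" for c
    using that by (metis (mono_tags, lifting) dvd_mult_div_cancel mem_Collect_eq mult_1_right)
  have "sum ?f ?C = sum ?f {c \<in> ?C. part_weight c = j}"
    using finC exact \<open>0 < j\<close> by (intro sum.mono_neutral_right) auto
  also have "\<dots> = (\<Sum>\<phi>\<in>Phi_level q j. of_nat (card \<phi>) * p_gen (j div card \<phi>) \<phi>)"
  proof (rule sum.reindex_bij_witness [of _ "\<lambda>\<phi>. (j div card \<phi>, \<phi>)" snd], goal_cases)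
    case (1 c)
    then show ?case using card_pos by (auto simp: part_weight_def)
  next
    case (2 c)
    then show ?case by (auto simp: part_weight_def Phi_level_def)
  next
    case (4 \<phi>)
    then show ?case using \<open>0 < j\<close>
      by (auto simp: part_weight_def Phi_level_def Suc_le_eq div_greater_zero_iff intro: dvd_imp_le dest: card_pos)
  next
    case (5 c)
    then obtain i \<phi> where c: "c = (i, \<phi>)" "0 < i" "\<phi> \<in> Phi q" and j: "i * card \<phi> = j"
      by (auto simp: part_weight_def)
    then have "j div card \<phi> = i" using card_pos by auto
    moreover have "of_nat (i * card \<phi>) * (cst (1 / of_nat i) * var c) = of_nat (card \<phi>) * var c"
      using c(2) unfolding cst_of_nat [symmetric] mult.assoc [symmetric] cst_mult [symmetric] by simp
    ultimately show ?case using c j \<open>0 < j\<close> by (simp add: part_weight_def p_gen_def)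
  qed simp
  finally show "sum ?f ?C = (\<Sum>\<phi>\<in>Phi_level q j. of_nat (card \<phi>) * p_gen (j div card \<phi>) \<phi>)" .
qed

text \<open>A family of partitions is the same as the family of the multiplicities of their parts.\<close>

lemma colored_sum_eq_weighted_sum:
  assumes card_pos: "\<And>\<phi> :: 'k::alg_closed_field orbit. \<phi> \<in> Phi q \<Longrightarrow> 0 < card \<phi>"
  shows "(\<Sum>\<Lambda>\<in>(colored_partitions q n :: ('k orbit \<Rightarrow> nat multiset) set). cst (1 / of_nat (Z_colored \<Lambda>)) * p_colored \<Lambda>) =
    weighted_sum ({1..} \<times> Phi q) part_weight part_term n"
  unfolding weighted_sum_def
proof (rule sum.reindex_bij_witness
    [of _ "\<lambda>\<nu> \<phi>. Abs_multiset (\<lambda>i. Poly_Mapping.lookup \<nu> (i, \<phi>))"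
          "\<lambda>\<Lambda>. Abs_poly_mapping (\<lambda>(i, \<phi>). count (\<Lambda> \<phi>) i)"])
  let ?parts = "\<lambda>\<nu> \<phi>. Abs_multiset (\<lambda>i. Poly_Mapping.lookup \<nu> (i, \<phi>))"
  let ?mult = "\<lambda>\<Lambda>. Abs_poly_mapping (\<lambda>(i, \<phi>). count (\<Lambda> \<phi>) i)"
  have count_parts: "count (?parts \<nu> \<phi>) i = Poly_Mapping.lookup \<nu> (i, \<phi>)"
    for \<nu> :: "nat \<times> 'k orbit \<Rightarrow>\<^sub>0 nat" and \<phi> i
  proof -
    have "finite {i. 0 < Poly_Mapping.lookup \<nu> (i, \<phi>)}"
      by (rule finite_subset [of _ "fst ` Poly_Mapping.keys \<nu>"]) (force simp: in_keys_iff)+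
    then show ?thesis by simp
  qed
  have lookup_mult: "Poly_Mapping.lookup (?mult \<Lambda>) (i, \<phi>) = count (\<Lambda> \<phi>) i"
    if "finite (supp \<Lambda>)" for \<Lambda> :: "'k orbit \<Rightarrow> nat multiset" and i \<phi>
  proof -
    have "{c. (case c of (i, \<phi>) \<Rightarrow> count (\<Lambda> \<phi>) i) \<noteq> 0} \<subseteq> (\<lambda>(\<phi>, i). (i, \<phi>)) ` (SIGMA \<phi>:supp \<Lambda>. set_mset (\<Lambda> \<phi>))"
      by (force simp: supp_def)
    moreover have "finite ((\<lambda>(\<phi>, i). (i, \<phi>)) ` (SIGMA \<phi>:supp \<Lambda>. set_mset (\<Lambda> \<phi>)))"
      using that by (intro finite_imageI finite_SigmaI) auto
    ultimately have "finite {c. (case c of (i, \<phi>) \<Rightarrow> count (\<Lambda> \<phi>) i) \<noteq> 0}"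
      by (rule finite_subset)
    then show ?thesis by simp
  qed
  have keys_mults: "Poly_Mapping.keys (?mult \<Lambda>) = prod.swap ` (SIGMA \<phi>:supp \<Lambda>. set_mset (\<Lambda> \<phi>))"
    if "finite (supp \<Lambda>)" for \<Lambda> :: "'k orbit \<Rightarrow> nat multiset"
    using lookup_mult [OF that] by (force simp: in_keys_iff supp_def image_iff)
  have sum_keys: "(\<Sum>c\<in>Poly_Mapping.keys (?mult \<Lambda>). f c) = (\<Sum>\<phi>\<in>supp \<Lambda>. \<Sum>i\<in>set_mset (\<Lambda> \<phi>). f (i, \<phi>))"
    if "finite (supp \<Lambda>)" for \<Lambda> :: "'k orbit \<Rightarrow> nat multiset" and f :: "_ \<Rightarrow> nat"
    using that unfolding keys_mults [OF that]
    by (subst sum.reindex) (auto simp: sum.Sigma inj_on_def split_def prod.swap_def)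
  have prod_keys: "(\<Prod>c\<in>Poly_Mapping.keys (?mult \<Lambda>). f c) = (\<Prod>\<phi>\<in>supp \<Lambda>. \<Prod>i\<in>set_mset (\<Lambda> \<phi>). f (i, \<phi>))"
    if "finite (supp \<Lambda>)" for \<Lambda> :: "'k orbit \<Rightarrow> nat multiset" and f :: "_ \<Rightarrow> 'k FG"
    using that unfolding keys_mults [OF that]
    by (subst prod.reindex) (auto simp: prod.Sigma inj_on_def split_def prod.swap_def)
  have weight: "(\<Sum>c\<in>Poly_Mapping.keys (?mult \<Lambda>). part_weight c * Poly_Mapping.lookup (?mult \<Lambda>) c) =
      (\<Sum>\<phi>\<in>supp \<Lambda>. card \<phi> * sum_mset (\<Lambda> \<phi>))" if "finite (supp \<Lambda>)" for \<Lambda> :: "'k orbit \<Rightarrow> nat multiset"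
  proof -
    have "sum_mset M = (\<Sum>i\<in>A. i * count M i)" if "finite A" "set_mset M \<subseteq> A" for M :: "nat multiset" and A
      using that(2)
    proof (induction M)
      case (add x M)
      have "i * count (add_mset x M) i = (if i = x then i else 0) + i * count M i" for i
        by simp
      with add that(1) show ?case by (simp only: sum.distrib) (simp add: sum.delta)
    qed simp
    from this [OF _ order_refl] have "sum_mset M = (\<Sum>i\<in>set_mset M. i * count M i)" for M :: "nat multiset"
      by simp
    then show ?thesis
      by (simp add: sum_keys [OF that] lookup_mult [OF that] part_weight_def sum_distrib_left mult_ac)
  qed
  have mult_parts: "?mult (?parts \<nu>) = \<nu>" for \<nu> :: "nat \<times> 'k orbit \<Rightarrow>\<^sub>0 nat"
    by (simp add: count_parts split_def)
  have supp_parts: "supp (?parts \<nu>) = snd ` Poly_Mapping.keys \<nu>" for \<nu> :: "nat \<times> 'k orbit \<Rightarrow>\<^sub>0 nat"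
    by (force simp: supp_def multiset_eq_iff count_parts in_keys_iff)
  {
    fix \<Lambda> :: "'k orbit \<Rightarrow> nat multiset" assume \<Lambda>: "\<Lambda> \<in> colored_partitions q n"
    then have fin: "finite (supp \<Lambda>)" by (simp add: colored_partitions_def)
    show "?parts (?mult \<Lambda>) = \<Lambda>"
      by (intro ext multiset_eqI) (simp add: count_parts lookup_mult [OF fin])
    show "?mult \<Lambda> \<in> weighted_maps ({1..} \<times> Phi q) part_weight n"
    proof -
      have "1 \<le> i" if "i \<in># \<Lambda> \<phi>" for i \<phi>
      proof (cases i)
        case 0
        then show ?thesis using \<Lambda> that by (auto simp: colored_partitions_def is_partition_def)
      qed simp
      moreover have "supp \<Lambda> \<subseteq> Phi q" "(\<Sum>\<phi>\<in>supp \<Lambda>. card \<phi> * sum_mset (\<Lambda> \<phi>)) = n"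
        using \<Lambda> by (simp_all add: colored_partitions_def)
      ultimately show ?thesis
        unfolding weighted_maps_def mem_Collect_eq weight [OF fin]
        unfolding keys_mults [OF fin] by auto
    qed
    show "(\<Prod>c\<in>Poly_Mapping.keys (?mult \<Lambda>). part_term c (Poly_Mapping.lookup (?mult \<Lambda>) c)) =
        cst (1 / of_nat (Z_colored \<Lambda>)) * p_colored \<Lambda>"
    proof -
      have part: "(\<Prod>i\<in>set_mset M. part_term (i, \<phi>) (count M i)) = cst (1 / of_nat (z_part M)) * p_part M \<phi>"
        for M and \<phi> :: "'k orbit"
        by (simp only: part_term_def prod.case z_part_def p_part_def cst_inverse_prod
            image_prod_mset_multiplicity) (rule prod.distrib)
      show ?thesis
        by (simp only: prod_keys [OF fin] lookup_mult [OF fin] part prod.distrib Z_colored_def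
            p_colored_def cst_inverse_prod)
    qed
  next
    fix \<nu> :: "nat \<times> 'k orbit \<Rightarrow>\<^sub>0 nat" assume \<nu>: "\<nu> \<in> weighted_maps ({1..} \<times> Phi q) part_weight n"
    show "?mult (?parts \<nu>) = \<nu>" by (rule mult_parts)
    have fin: "finite (supp (?parts \<nu>))" by (simp add: supp_parts)
    have "(\<Sum>\<phi>\<in>supp (?parts \<nu>). card \<phi> * sum_mset (?parts \<nu> \<phi>)) = n"
      using \<nu> weight [OF fin] by (simp add: mult_parts weighted_maps_def)
    moreover have "0 \<notin># ?parts \<nu> \<phi>" for \<phi>
    proof -
      have "(0, \<phi>) \<notin> Poly_Mapping.keys \<nu>" using \<nu> by (auto simp: weighted_maps_def)
      then have "count (?parts \<nu> \<phi>) 0 = 0" by (simp only: count_parts in_keys_iff not_not)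
      then show ?thesis by (rule count_eq_zero_iff [THEN iffD1])
    qed
    ultimately show "?parts \<nu> \<in> colored_partitions q n"
      using \<nu> by (auto simp: colored_partitions_def supp_parts weighted_maps_def is_partition_def)
  }
qed

lemma row_eq_iff: "is_partition \<mu> \<and> size \<mu> \<le> 1 \<longleftrightarrow> row (sum_mset \<mu>) = \<mu>"
proof
  assume "is_partition \<mu> \<and> size \<mu> \<le> 1"
  moreover from this have "\<mu> = {#} \<or> (\<exists>i. \<mu> = {#i#})"
    by (metis One_nat_def le_SucE le_zero_eq size_1_singleton_mset size_eq_0_iff_empty)
  ultimately show "row (sum_mset \<mu>) = \<mu>" by (auto simp: row_def is_partition_def)
next
  assume *: "row (sum_mset \<mu>) = \<mu>"
  have "is_partition (row i) \<and> size (row i) \<le> 1" for i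
    by (simp add: row_def is_partition_def)
  from this [of "sum_mset \<mu>"] show "is_partition \<mu> \<and> size \<mu> \<le> 1" by (simp add: *)
qed

text \<open>Partitions with at most one part are determined by their weight.\<close>

lemma row_colored_sum_eq_weighted_sum:
  "(\<Sum>\<Lambda>\<in>{\<Lambda> \<in> colored_partitions q n. \<forall>\<phi>\<in>Phi q. size (\<Lambda> \<phi>) \<le> 1}. schur_colored \<Lambda>) =
    weighted_sum (Phi q) card (\<lambda>\<phi> i. schur (row i) \<phi>) n"
  unfolding weighted_sum_def
proof (rule sum.reindex_bij_witness
    [of _ "\<lambda>\<nu> \<phi>. row (Poly_Mapping.lookup \<nu> \<phi>)" "\<lambda>\<Lambda>. Abs_poly_mapping (\<lambda>\<phi>. sum_mset (\<Lambda> \<phi>))"])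
  let ?rows = "\<lambda>\<nu> \<phi>. row (Poly_Mapping.lookup \<nu> \<phi>)"
  let ?sizes = "\<lambda>\<Lambda>. Abs_poly_mapping (\<lambda>\<phi>. sum_mset (\<Lambda> \<phi>))"
  have row_simps: "sum_mset (row i) = i" "row i = {#} \<longleftrightarrow> i = 0" for i
    by (auto simp: row_def)
  {
    fix \<Lambda> :: "'a orbit \<Rightarrow> nat multiset"
    assume \<Lambda>: "\<Lambda> \<in> {\<Lambda> \<in> colored_partitions q n. \<forall>\<phi>\<in>Phi q. size (\<Lambda> \<phi>) \<le> 1}"
    then have fin: "finite (supp \<Lambda>)" by (simp add: colored_partitions_def)
    have row: "row (sum_mset (\<Lambda> \<phi>)) = \<Lambda> \<phi>" for \<phi>
    proof (cases "\<phi> \<in> Phi q")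
      case True
      then show ?thesis using \<Lambda> row_eq_iff [of "\<Lambda> \<phi>"] by (auto simp: colored_partitions_def)
    next
      case False
      then have "\<Lambda> \<phi> = {#}" using \<Lambda> by (auto simp: colored_partitions_def supp_def)
      then show ?thesis by (simp add: row_def)
    qed
    then have zero: "sum_mset (\<Lambda> \<phi>) = 0 \<longleftrightarrow> \<Lambda> \<phi> = {#}" for \<phi>
      using row_simps(2) by metis
    have lookup: "Poly_Mapping.lookup (?sizes \<Lambda>) \<phi> = sum_mset (\<Lambda> \<phi>)" for \<phi>
      using fin by (subst lookup_Abs_poly_mapping) (simp_all only: zero supp_def)
    have keys: "Poly_Mapping.keys (?sizes \<Lambda>) = supp \<Lambda>"
      by (rule set_eqI) (simp only: in_keys_iff lookup zero supp_def mem_Collect_eq)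
    show "?rows (?sizes \<Lambda>) = \<Lambda>" by (simp add: lookup row)
    show "?sizes \<Lambda> \<in> weighted_maps (Phi q) card n"
      using \<Lambda> by (simp add: weighted_maps_def keys lookup colored_partitions_def)
    show "(\<Prod>\<phi>\<in>Poly_Mapping.keys (?sizes \<Lambda>). schur (row (Poly_Mapping.lookup (?sizes \<Lambda>) \<phi>)) \<phi>) = schur_colored \<Lambda>"
      by (simp add: keys lookup row schur_colored_def)
  next
    fix \<nu> :: "'a orbit \<Rightarrow>\<^sub>0 nat" assume \<nu>: "\<nu> \<in> weighted_maps (Phi q) card n"
    show "?sizes (?rows \<nu>) = \<nu>" by (simp add: row_simps)
    have supp: "supp (?rows \<nu>) = Poly_Mapping.keys \<nu>"
      by (auto simp: supp_def row_simps in_keys_iff)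
    have "is_partition (row i)" "size (row i) \<le> 1" for i
      by (auto simp: row_def is_partition_def)
    then show "?rows \<nu> \<in> {\<Lambda> \<in> colored_partitions q n. \<forall>\<phi>\<in>Phi q. size (\<Lambda> \<phi>) \<le> 1}"
      using \<nu> by (simp add: colored_partitions_def supp row_simps weighted_maps_def)
  }
qed

section \<open>The coefficients of the exponential series\<close>

text \<open>This is where \<open>1 - q\<^sup>-\<^sup>j = (q\<^sup>j - 1) / q\<^sup>j\<close> cancels the denominator of \<open>p\<^sub>j(f\<^sub>1)\<close>; the signs combine to \<open>(-1)\<^sup>j\<close>.\<close>

lemma q_exponent_coefficient:
  assumes "1 < q" "0 < j"
  shows "(of_nat j * - (cst ((1 - 1 / of_nat q ^ j) / of_nat j) * p_f1 q j) :: 'k::alg_closed_field FG) =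
    cst ((- 1 / of_nat q) ^ j) * (\<Sum>\<phi>\<in>Phi_level q j. of_nat (card \<phi>) * p_gen (j div card \<phi>) \<phi>)"
proof -
  have coeff: "i * - ((1 - 1 / x) / i) * (- y / (x - 1)) = y / x"
    if "i \<noteq> 0" "x \<noteq> 0" "x \<noteq> 1" for i x y :: complex
    using that by (simp add: field_simps)
  have "(of_nat q :: complex) ^ j \<noteq> 1"
    using one_less_power [OF assms] by (metis of_nat_1 of_nat_eq_iff of_nat_power less_irrefl)
  moreover have "(- 1 :: complex) ^ (j - 1) = - ((- 1) ^ j)"
    using assms(2) by (cases j) simp_all
  ultimately have "of_nat j * - ((1 - 1 / of_nat q ^ j) / of_nat j) * ((- 1) ^ (j - 1) / (of_nat q ^ j - 1))
      = (- 1 / of_nat q :: complex) ^ j"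
    using coeff [of "of_nat j" "of_nat q ^ j" "(- 1) ^ j"] assms
    unfolding power_divide by simp
  then have "of_nat j * cst (- ((1 - 1 / of_nat q ^ j) / of_nat j)) * cst ((- 1) ^ (j - 1) / (of_nat q ^ j - 1))
      = (cst ((- 1 / of_nat q) ^ j) :: 'k FG)"
    unfolding cst_of_nat [symmetric] cst_mult [symmetric] by (rule arg_cong)
  moreover have "(of_nat j * - (cst ((1 - 1 / of_nat q ^ j) / of_nat j) * p_f1 q j) :: 'k FG) =
      of_nat j * cst (- ((1 - 1 / of_nat q ^ j) / of_nat j)) * cst ((- 1) ^ (j - 1) / (of_nat q ^ j - 1)) *
      (\<Sum>\<phi>\<in>Phi_level q j. of_nat (card \<phi>) * p_gen (j div card \<phi>) \<phi>)"
    by (simp add: p_f1_def cst_uminus mult.assoc)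
  ultimately show ?thesis by (simp only:)
qed

theorem theorem3p1:
  fixes p e q :: nat
    and qY :: "nat \<Rightarrow> 'k::alg_closed_field FG"
  assumes "prime p" and "0 < e" and "q = p ^ e"
    and "CHAR('k) = p"
    and gen: "Abs_fps qY =
       exp_fps (- Abs_fps (\<lambda>n. if n = 0 then 0
                               else cst ((1 - 1 / of_nat q ^ n) / of_nat n) * p_f1 q n))"
  shows "qY n \<in> F_G q \<and>
     qY n = cst ((-1 / of_nat q) ^ n) *
           (\<Sum>\<Lambda>\<in>colored_partitions q n. cst (1 / of_nat (Z_colored \<Lambda>)) * p_colored \<Lambda>) \<and>
     qY n = cst ((-1 / of_nat q) ^ n) *
           (\<Sum>\<Lambda>\<in>{\<Lambda> \<in> colored_partitions q n. \<forall>\<phi>\<in>Phi q. size (\<Lambda> \<phi>) \<le> 1}. schur_colored \<Lambda>)"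
proof -
  have q: "1 < q"
    using assms(1-3) by (metis one_less_power prime_gt_1_nat)
  note card_pos = Phi_orbit(1) [OF q] and fin = finite_Phi_level [OF q]
  define g :: "nat \<Rightarrow> 'k FG"
    where "g j = (\<Sum>\<phi>\<in>Phi_level q j. of_nat (card \<phi>) * p_gen (j div card \<phi>) \<phi>)" for j
  define s :: complex where "s = - 1 / of_nat q"
  define F :: "'k FG fps" where "F = - Abs_fps (\<lambda>n. if n = 0 then 0
    else cst ((1 - 1 / of_nat q ^ n) / of_nat n) * p_f1 q n)"
  have qY: "qY n = exp_fps F $ n" for n
    using gen by (metis F_def fps_nth_Abs_fps)
  have qY_rec: "of_nat n * qY n = (\<Sum>j=1..n. cst (s ^ j) * g j * qY (n - j))" for n
  proof -
    have "of_nat j * F $ j = cst (s ^ j) * g j" if "0 < j" for j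
      using q_exponent_coefficient [OF q that] that by (simp add: F_def s_def g_def)
    moreover have "F $ 0 = 0" by (simp add: F_def)
    ultimately show ?thesis
      unfolding qY by (subst exp_fps_nth_rec) (auto intro!: sum.cong)
  qed
  \<comment> \<open>Rescaling by powers of \<open>s\<close>, that is, replacing \<open>z\<close> by \<open>s z\<close>, reduces both formulas to a recursion without \<open>s\<close>.\<close>
  have qY_eq: "qY n = cst (s ^ n) * H n"
    if "H 0 = 1" and H: "\<And>n. of_nat n * H n = (\<Sum>j=1..n. g j * H (n - j))" for H n
  proof (rule newton_recursion_unique [where E = qY and H = "\<lambda>n. cst (s ^ n) * H n"
        and a = "\<lambda>j. cst (s ^ j) * g j"])
    show "qY 0 = cst (s ^ 0) * H 0"
      by (simp add: qY exp_fps_def cst_one \<open>H 0 = 1\<close>)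
    show "of_nat n * (cst (s ^ n) * H n) = (\<Sum>j=1..n. cst (s ^ j) * g j * (cst (s ^ (n - j)) * H (n - j)))" for n
    proof -
      have "of_nat n * (cst (s ^ n) * H n) = cst (s ^ n) * (\<Sum>j=1..n. g j * H (n - j))"
        by (simp only: H [symmetric] mult.left_commute)
      also have "\<dots> = (\<Sum>j=1..n. cst (s ^ j) * g j * (cst (s ^ (n - j)) * H (n - j)))"
        unfolding sum_distrib_left
      proof (rule sum.cong [OF refl])
        fix j assume "j \<in> {1..n}"
        then have "s ^ n = s ^ j * s ^ (n - j)" by (simp flip: power_add)
        then show "cst (s ^ n) * (g j * H (n - j)) = cst (s ^ j) * g j * (cst (s ^ (n - j)) * H (n - j))"
          by (simp add: cst_mult mult_ac)
      qed
      finally show ?thesis .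
    qed
  qed (rule qY_rec)
  have parts: "qY n = cst (s ^ n) * weighted_sum ({1..} \<times> Phi q) part_weight part_term n"
  proof (rule qY_eq)
    have pos: "0 < part_weight c" if "c \<in> {1..} \<times> Phi q" for c :: "nat \<times> 'k orbit"
      using that card_pos by (auto simp: part_weight_def Suc_le_eq)
    show "weighted_sum ({1..} \<times> Phi q) part_weight part_term 0 = (1 :: 'k FG)"
      by (rule weighted_sum_0 [OF pos])
    show "of_nat n * weighted_sum ({1..} \<times> Phi q) part_weight part_term n =
        (\<Sum>j=1..n. g j * weighted_sum ({1..} \<times> Phi q) part_weight part_term (n - j))" for n
    proof -
      let ?W = "weighted_sum ({1..} \<times> Phi q) part_weight part_term :: nat \<Rightarrow> 'k FG"
      let ?p = "\<lambda>c k. if k = 1 then cst (1 / of_nat (fst c)) * var c else 0"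
      have "of_nat n * ?W n = (\<Sum>j=1..n.
          (\<Sum>c\<in>{c \<in> {1..} \<times> Phi q. part_weight c dvd j}.
             of_nat (part_weight c) * ?p c (j div part_weight c)) * ?W (n - j))"
      proof (rule weighted_sum_newton [OF pos])
        show "finite {c \<in> {1..} \<times> (Phi q :: 'k orbit set). part_weight c dvd j}" if "0 < j" for j
          using card_pos fin [OF that] that by (rule power_sum_coeff_parts(1))
      qed (rule part_term_newton | simp add: part_term_def cst_one split_def)+
      also have "\<dots> = (\<Sum>j=1..n. g j * ?W (n - j))"
      proof (rule sum.cong [OF refl])
        fix j assume "j \<in> {1..n}"
        then have "0 < j" by simp
        show "(\<Sum>c\<in>{c \<in> {1..} \<times> Phi q. part_weight c dvd j}.
             of_nat (part_weight c) * ?p c (j div part_weight c)) * ?W (n - j) = g j * ?W (n - j)"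
          by (simp only: power_sum_coeff_parts(2) [OF card_pos fin [OF \<open>0 < j\<close>] \<open>0 < j\<close>] g_def)
      qed
      finally show ?thesis .
    qed
  qed
  have rows: "qY n = cst (s ^ n) * weighted_sum (Phi q) card (\<lambda>\<phi> i. schur (row i) \<phi>) n"
  proof (rule qY_eq)
    show "weighted_sum (Phi q) card (\<lambda>\<phi> i. schur (row i) \<phi>) 0 = (1 :: 'k FG)"
      by (rule weighted_sum_0 [OF card_pos])
    show "of_nat n * weighted_sum (Phi q) card (\<lambda>\<phi> i. schur (row i) \<phi>) n =
        (\<Sum>j=1..n. g j * weighted_sum (Phi q) card (\<lambda>\<phi> i. schur (row i) \<phi>) (n - j))" for n
      unfolding g_def Phi_level_def
      using fin by (intro weighted_sum_newton card_pos schur_row_0 schur_row_newton) (auto simp: Phi_level_def)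
  qed
  have "weighted_sum ({1..} \<times> Phi q) part_weight part_term n \<in> F_G q"
    unfolding weighted_sum_def F_G_eq
    by (intro polys_in_sum polys_in_prod)
      (auto simp: part_term_def p_gen_def weighted_maps_def
        intro!: polys_in_mult polys_in_cst polys_in_power polys_in_var)
  then have "qY n \<in> F_G q"
    unfolding parts F_G_eq by (intro polys_in_mult polys_in_cst)
  moreover have "(\<Sum>\<Lambda>\<in>(colored_partitions q n :: ('k orbit \<Rightarrow> nat multiset) set).
      cst (1 / of_nat (Z_colored \<Lambda>)) * p_colored \<Lambda>) =
      weighted_sum ({1..} \<times> Phi q) part_weight part_term n"
    by (rule colored_sum_eq_weighted_sum) (rule card_pos)
  ultimately show ?thesis
    using parts rows by (simp only: row_colored_sum_eq_weighted_sum s_def)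
qed

end
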